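(* Let $(M,g)$ be a complete Riemannian manifold, $o\in M$ a fixed origin and $\alpha\in(0,1)$. If the Riesz field $R^\alpha$ exists over $M$, then it has stationary increments; if the stationary Riesz field $hR^\alpha$ exists over $M$, then it is stationary.
   Context: Conventions: Riemannian manifolds are connected, complete, and of dimension $d$ with $2\le d<\infty$. $\Delta$ is the Laplace–Beltrami operator of $M$ (its unique self-adjoint extension, with spectrum in $(-\infty,0]$), $dV_g$ is the Riemannian measure, and $H_t(x,y)$, $t>0$, is the heat kernel of $M$, i.e. the smooth integral kernel of $e^{t\Delta}$ on $L^2(M,dV_g)$. A Gaussian random field (GRF) over a set $I$ is a family of random variables $\{X_i\}_{i\in I}$ on a complete probability space all of whose finite subfamilies are jointly normal; it is centered if $\mathbb{E}[X_i]=0$ for all $i$, and is then determined in distribution by its covariance $\mathbb{E}[X_sX_t]$. Let $I(M)$ be the group of isometries of $(M,g)$. A centered GRF $Y_x$ over $M$ is stationary if $\mathbb{E}[Y_{\iota(x)}Y_{\iota(y)}]=\mathbb{E}[Y_xY_y]$ for all $\iota\in I(M)$ and all $x,y\in M$; it has stationary increments if $\mathbb{E}[|Y_{\iota(x)}-Y_{\iota(y)}|^2]=\mathbb{E}[|Y_x-Y_y|^2]$ for all $\iota\in I(M)$ and all $x,y\in M$. For a fixed origin $o\in M$ and $\alpha\in(0,1)$, the Riesz field $R^\alpha$ is the centered GRF over $M$ with covariance $$\mathbb{E}[R^\alpha_xR^\alpha_y]=\frac1{\Gamma\left(\frac d2+\alpha\right)}\int_0^\infty t^{\frac d2+\alpha-1}\left(H_t(x,y)-H_t(x,o)-H_t(y,o)+H_t(o,o)\right)dt,$$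 and the stationary Riesz field $hR^\alpha$ is the centered GRF over $M$ with covariance $$\mathbb{E}[hR^\alpha_xhR^\alpha_y]=\frac1{\Gamma\left(\frac d2+\alpha\right)}\int_0^\infty t^{\frac d2+\alpha-1}H_t(x,y)\,dt.$$ One says $R^\alpha$ (resp. $hR^\alpha$) exists over $M$ if the corresponding integral converges to a finite value for all $x,y\in M$. *)

theory Defs
  imports "HOL-Probability.Probability"
begin

section \<open>Smooth functions between Euclidean spaces\<close>

text \<open>Only used for open S. For finite-dimensional domains this is the usual notion of
  a function of class C-k: all iterated directional derivatives up to order k exist, and
  all of them are continuous.\<close>

fun Ck_on :: "nat \<Rightarrow> 'b::real_normed_vector set \<Rightarrow> ('b \<Rightarrow> 'c::real_normed_vector) \<Rightarrow> bool" where
  "Ck_on 0 S f \<longleftrightarrow> continuous_on S f"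
| "Ck_on (Suc k) S f \<longleftrightarrow>
     (\<forall>x\<in>S. f differentiable (at x)) \<and> (\<forall>v. Ck_on k S (\<lambda>x. frechet_derivative f (at x) v))"

definition smooth_on :: "'b::real_normed_vector set \<Rightarrow> ('b \<Rightarrow> 'c::real_normed_vector) \<Rightarrow> bool" where
  "smooth_on S f \<longleftrightarrow> (\<forall>k. Ck_on k S f)"

section \<open>Smooth manifolds\<close>

text \<open>The manifold is the whole type \<^typ>\<open>'a\<close>. A chart is a pair of its domain and a
  coordinate map; the values of the coordinate map outside the domain are irrelevant.\<close>

type_synonym ('a, 'd) chart = "'a set \<times> ('a \<Rightarrow> real ^ 'd)"

definition topological_chart :: "('a::topological_space, 'd::finite) chart \<Rightarrow> bool" where
  "topological_chart c \<longleftrightarrow> open (fst c) \<and> open (snd c ` fst c) \<and>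
     homeomorphism (fst c) (snd c ` fst c) (snd c) (inv_into (fst c) (snd c))"

definition local_rep ::
  "('a, 'd::finite) chart \<Rightarrow> ('a, 'd) chart \<Rightarrow> ('a \<Rightarrow> 'a) \<Rightarrow> real ^ 'd \<Rightarrow> real ^ 'd" where
  "local_rep c c' f = (\<lambda>u. snd c' (f (inv_into (fst c) (snd c) u)))"

definition transition ::
  "('a, 'd::finite) chart \<Rightarrow> ('a, 'd) chart \<Rightarrow> real ^ 'd \<Rightarrow> real ^ 'd" where
  "transition c c' = local_rep c c' (\<lambda>x. x)"

definition smoothly_compatible :: "('a, 'd::finite) chart \<Rightarrow> ('a, 'd) chart \<Rightarrow> bool" where
  "smoothly_compatible c c' \<longleftrightarrow>
     smooth_on (snd c ` (fst c \<inter> fst c')) (transition c c') \<and>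
     smooth_on (snd c' ` (fst c \<inter> fst c')) (transition c' c)"

text \<open>A smooth structure is a maximal smooth atlas.\<close>

definition smooth_structure :: "('a::topological_space, 'd::finite) chart set \<Rightarrow> bool" where
  "smooth_structure A \<longleftrightarrow>
     (\<forall>c\<in>A. topological_chart c) \<and>
     (\<Union>c\<in>A. fst c) = UNIV \<and>
     (\<forall>c\<in>A. \<forall>c'\<in>A. smoothly_compatible c c') \<and>
     (\<forall>c. topological_chart c \<and> (\<forall>c'\<in>A. smoothly_compatible c c') \<longrightarrow> c \<in> A)"

definition smooth_fun :: "('a::topological_space, 'd::finite) chart set \<Rightarrow> ('a \<Rightarrow> real) \<Rightarrow> bool" where
  "smooth_fun A f \<longleftrightarrow>
     (\<forall>c\<in>A. smooth_on (snd c ` fst c) (\<lambda>u. f (inv_into (fst c) (snd c) u)))"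

definition smooth_map :: "('a::topological_space, 'd::finite) chart set \<Rightarrow> ('a \<Rightarrow> 'a) \<Rightarrow> bool" where
  "smooth_map A f \<longleftrightarrow> continuous_on UNIV f \<and>
     (\<forall>c\<in>A. \<forall>c'\<in>A. smooth_on (snd c ` (fst c \<inter> f -` fst c')) (local_rep c c' f))"

section \<open>Riemannian manifolds\<close>

text \<open>A Riemannian metric is given by its coefficient matrices: \<open>g c x\<close> is the Gram matrix, at
  the point x, of the coordinate frame of the chart c. The last condition is the
  transformation law of a covariant 2-tensor.\<close>

definition riemannian_metric ::
  "('a::topological_space, 'd::finite) chart set \<Rightarrow>
   (('a, 'd) chart \<Rightarrow> 'a \<Rightarrow> real ^ 'd ^ 'd) \<Rightarrow> bool" where
  "riemannian_metric A g \<longleftrightarrow>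
     (\<forall>c\<in>A. \<forall>x\<in>fst c. transpose (g c x) = g c x \<and> (\<forall>v. v \<noteq> 0 \<longrightarrow> 0 < v \<bullet> (g c x *v v))) \<and>
     (\<forall>c\<in>A. smooth_on (snd c ` fst c) (\<lambda>u. g c (inv_into (fst c) (snd c) u))) \<and>
     (\<forall>c\<in>A. \<forall>c'\<in>A. \<forall>x\<in>fst c \<inter> fst c'.
        let J = jacobian (transition c c') (at (snd c x))
        in g c x = transpose J ** g c' x ** J)"

definition riemannian_manifold ::
  "('a::{second_countable_topology, t2_space}, 'd::finite) chart set \<Rightarrow>
   (('a, 'd) chart \<Rightarrow> 'a \<Rightarrow> real ^ 'd ^ 'd) \<Rightarrow> bool" where
  "riemannian_manifold A g \<longleftrightarrow>
     connected (UNIV :: 'a set) \<and> smooth_structure A \<and> riemannian_metric A g"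

definition isometries ::
  "('a::topological_space, 'd::finite) chart set \<Rightarrow>
   (('a, 'd) chart \<Rightarrow> 'a \<Rightarrow> real ^ 'd ^ 'd) \<Rightarrow> ('a \<Rightarrow> 'a) set" where
  "isometries A g = {f. bij f \<and> smooth_map A f \<and> smooth_map A (inv f) \<and>
     (\<forall>c\<in>A. \<forall>c'\<in>A. \<forall>x\<in>fst c. f x \<in> fst c' \<longrightarrow>
        (let J = jacobian (local_rep c c' f) (at (snd c x))
         in g c x = transpose J ** g c' (f x) ** J))}"

subsection \<open>Riemannian distance and completeness\<close>

definition piecewise_C1_path :: "('a::topological_space, 'd::finite) chart set \<Rightarrow> (real \<Rightarrow> 'a) \<Rightarrow> bool" where
  "piecewise_C1_path A p \<longleftrightarrow> continuous_on {0..1} p \<and>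
     (\<forall>c\<in>A. \<forall>a b. 0 \<le> a \<and> a \<le> b \<and> b \<le> 1 \<and> p ` {a..b} \<subseteq> fst c \<longrightarrow>
        (\<lambda>t. snd c (p t)) piecewise_C1_differentiable_on {a..b})"

text \<open>By the transformation law the speed does not depend on the chosen chart.\<close>

definition speed ::
  "('a, 'd::finite) chart set \<Rightarrow> (('a, 'd) chart \<Rightarrow> 'a \<Rightarrow> real ^ 'd ^ 'd) \<Rightarrow>
   (real \<Rightarrow> 'a) \<Rightarrow> real \<Rightarrow> real" where
  "speed A g p t =
     (let c = (SOME c. c \<in> A \<and> p t \<in> fst c);
          v = vector_derivative (\<lambda>s. snd c (p s)) (at t)
      in sqrt (v \<bullet> (g c (p t) *v v)))"

definition path_len ::
  "('a, 'd::finite) chart set \<Rightarrow> (('a, 'd) chart \<Rightarrow> 'a \<Rightarrow> real ^ 'd ^ 'd) \<Rightarrow>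
   (real \<Rightarrow> 'a) \<Rightarrow> ennreal" where
  "path_len A g p = (\<integral>\<^sup>+ t. ennreal (speed A g p t) * indicator {0..1} t \<partial>lborel)"

definition riemannian_dist ::
  "('a::topological_space, 'd::finite) chart set \<Rightarrow>
   (('a, 'd) chart \<Rightarrow> 'a \<Rightarrow> real ^ 'd ^ 'd) \<Rightarrow> 'a \<Rightarrow> 'a \<Rightarrow> ennreal" where
  "riemannian_dist A g x y =
     Inf (path_len A g ` {p. piecewise_C1_path A p \<and> p 0 = x \<and> p 1 = y})"

definition riemannian_complete ::
  "('a::topological_space, 'd::finite) chart set \<Rightarrow>
   (('a, 'd) chart \<Rightarrow> 'a \<Rightarrow> real ^ 'd ^ 'd) \<Rightarrow> bool" where
  "riemannian_complete A g \<longleftrightarrow>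
     (\<forall>X :: nat \<Rightarrow> 'a.
        (\<forall>e>0. \<exists>N. \<forall>m\<ge>N. \<forall>n\<ge>N. riemannian_dist A g (X m) (X n) < ennreal e) \<longrightarrow>
        (\<exists>x. \<forall>e>0. \<exists>N. \<forall>n\<ge>N. riemannian_dist A g (X n) x < ennreal e))"

subsection \<open>Riemannian measure\<close>

definition riemannian_measure ::
  "('a::topological_space, 'd::finite) chart set \<Rightarrow>
   (('a, 'd) chart \<Rightarrow> 'a \<Rightarrow> real ^ 'd ^ 'd) \<Rightarrow> 'a measure \<Rightarrow> bool" where
  "riemannian_measure A g V \<longleftrightarrow> sets V = sets borel \<and>
     (\<forall>c\<in>A. \<forall>B\<in>sets borel. B \<subseteq> fst c \<longrightarrow>
        emeasure V B =
          (\<integral>\<^sup>+ u. ennreal (sqrt (det (g c (inv_into (fst c) (snd c) u)))) *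
                  indicator (snd c ` B) u \<partial>lborel))"

section \<open>Unbounded operators and semigroups on L2\<close>

text \<open>Elements of L2 are represented by functions, and identified when equal almost
  everywhere. An unbounded operator is given by its graph.\<close>

definition L2 :: "'a measure \<Rightarrow> ('a \<Rightarrow> real) set" where
  "L2 V = {f \<in> borel_measurable V. integrable V (\<lambda>x. (f x)\<^sup>2)}"

definition L2_inner :: "'a measure \<Rightarrow> ('a \<Rightarrow> real) \<Rightarrow> ('a \<Rightarrow> real) \<Rightarrow> real" where
  "L2_inner V f h = (\<integral>x. f x * h x \<partial>V)"

definition L2_norm :: "'a measure \<Rightarrow> ('a \<Rightarrow> real) \<Rightarrow> real" where
  "L2_norm V f = sqrt (L2_inner V f f)"

definition L2_adjoint ::
  "'a measure \<Rightarrow> (('a \<Rightarrow> real) \<times> ('a \<Rightarrow> real)) set \<Rightarrow> (('a \<Rightarrow> real) \<times> ('a \<Rightarrow> real)) set" where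
  "L2_adjoint V D = {(f, h). f \<in> L2 V \<and> h \<in> L2 V \<and>
     (\<forall>(u, w)\<in>D. L2_inner V w f = L2_inner V u h)}"

text \<open>A set of pairs that equals its adjoint is automatically linear and closed, and closed
  under almost everywhere equality.\<close>

definition L2_self_adjoint :: "'a measure \<Rightarrow> (('a \<Rightarrow> real) \<times> ('a \<Rightarrow> real)) set \<Rightarrow> bool" where
  "L2_self_adjoint V D \<longleftrightarrow>
     (\<forall>f\<in>L2 V. \<forall>e>0. \<exists>(u, w)\<in>D. L2_norm V (\<lambda>x. f x - u x) < e) \<and>
     (\<forall>f h k. (f, h) \<in> D \<and> (f, k) \<in> D \<longrightarrow> (AE x in V. h x = k x)) \<and>
     L2_adjoint V D = D"

definition L2_contraction :: "'a measure \<Rightarrow> (('a \<Rightarrow> real) \<Rightarrow> ('a \<Rightarrow> real)) \<Rightarrow> bool" where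
  "L2_contraction V T \<longleftrightarrow>
     (\<forall>f\<in>L2 V. T f \<in> L2 V) \<and>
     (\<forall>f\<in>L2 V. \<forall>h\<in>L2 V. \<forall>a b.
        AE x in V. T (\<lambda>y. a * f y + b * h y) x = a * T f x + b * T h x) \<and>
     (\<forall>f\<in>L2 V. L2_norm V (T f) \<le> L2_norm V f)"

text \<open>Strongly continuous contraction semigroups; only the values at times \<open>t \<ge> 0\<close> matter.\<close>

definition contraction_semigroup :: "'a measure \<Rightarrow> (real \<Rightarrow> ('a \<Rightarrow> real) \<Rightarrow> ('a \<Rightarrow> real)) \<Rightarrow> bool" where
  "contraction_semigroup V T \<longleftrightarrow>
     (\<forall>t\<ge>0. L2_contraction V (T t)) \<and>
     (\<forall>f\<in>L2 V. AE x in V. T 0 f x = f x) \<and>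
     (\<forall>s\<ge>0. \<forall>t\<ge>0. \<forall>f\<in>L2 V. AE x in V. T (s + t) f x = T s (T t f) x) \<and>
     (\<forall>f\<in>L2 V. ((\<lambda>t. L2_norm V (\<lambda>x. T t f x - f x)) \<longlongrightarrow> 0) (at_right 0))"

definition generator ::
  "'a measure \<Rightarrow> (real \<Rightarrow> ('a \<Rightarrow> real) \<Rightarrow> ('a \<Rightarrow> real)) \<Rightarrow> (('a \<Rightarrow> real) \<times> ('a \<Rightarrow> real)) set" where
  "generator V T = {(f, h). f \<in> L2 V \<and> h \<in> L2 V \<and>
     ((\<lambda>t. L2_norm V (\<lambda>x. (T t f x - f x) / t - h x)) \<longlongrightarrow> 0) (at_right 0)}"

section \<open>Laplace-Beltrami operator and heat kernel\<close>

definition partial :: "'d::finite \<Rightarrow> (real ^ 'd \<Rightarrow> real) \<Rightarrow> real ^ 'd \<Rightarrow> real" where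
  "partial i F u = frechet_derivative F (at u) (axis i 1)"

definition laplacian_in_chart ::
  "(('a, 'd::finite) chart \<Rightarrow> 'a \<Rightarrow> real ^ 'd ^ 'd) \<Rightarrow> ('a, 'd) chart \<Rightarrow> ('a \<Rightarrow> real) \<Rightarrow> 'a \<Rightarrow> real" where
  "laplacian_in_chart g c f x =
     (let q = inv_into (fst c) (snd c); G = (\<lambda>u. g c (q u)) in
      (\<Sum>i\<in>UNIV. partial i
         (\<lambda>u. sqrt (det (G u)) *
              (\<Sum>j\<in>UNIV. matrix_inv (G u) $ i $ j * partial j (\<lambda>w. f (q w)) u))
         (snd c x)) / sqrt (det (g c x)))"

text \<open>The graph of the Laplace-Beltrami operator on smooth functions with compact support.
  The coordinate expression is the same in all charts, so each such f has exactly one h.\<close>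

definition laplacian_Cc ::
  "('a::topological_space, 'd::finite) chart set \<Rightarrow>
   (('a, 'd) chart \<Rightarrow> 'a \<Rightarrow> real ^ 'd ^ 'd) \<Rightarrow> (('a \<Rightarrow> real) \<times> ('a \<Rightarrow> real)) set" where
  "laplacian_Cc A g = {(f, h). smooth_fun A f \<and> compact (closure {x. f x \<noteq> 0}) \<and>
     (\<forall>c\<in>A. \<forall>x\<in>fst c. h x = laplacian_in_chart g c f x)}"

text \<open>The (unique) self-adjoint extension of the operator above. Its spectrum is automatically
  contained in the nonpositive reals.\<close>

definition is_laplacian ::
  "('a::topological_space, 'd::finite) chart set \<Rightarrow>
   (('a, 'd) chart \<Rightarrow> 'a \<Rightarrow> real ^ 'd ^ 'd) \<Rightarrow> 'a measure \<Rightarrow>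
   (('a \<Rightarrow> real) \<times> ('a \<Rightarrow> real)) set \<Rightarrow> bool" where
  "is_laplacian A g V D \<longleftrightarrow>
     L2_self_adjoint V D \<and> laplacian_Cc A g \<subseteq> D \<and>
     (\<forall>D'. L2_self_adjoint V D' \<and> laplacian_Cc A g \<subseteq> D' \<longrightarrow> D' = D)"

text \<open>The operators \<open>T t\<close> are the exponentials of t times the Laplacian: as the Laplacian is
  self-adjoint and nonpositive, these form the strongly continuous contraction semigroup that
  it generates.\<close>

definition is_heat_semigroup ::
  "('a::topological_space, 'd::finite) chart set \<Rightarrow>
   (('a, 'd) chart \<Rightarrow> 'a \<Rightarrow> real ^ 'd ^ 'd) \<Rightarrow> 'a measure \<Rightarrow>
   (real \<Rightarrow> ('a \<Rightarrow> real) \<Rightarrow> ('a \<Rightarrow> real)) \<Rightarrow> bool" where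
  "is_heat_semigroup A g V T \<longleftrightarrow> contraction_semigroup V T \<and> is_laplacian A g V (generator V T)"

definition is_heat_kernel ::
  "('a::topological_space, 'd::finite) chart set \<Rightarrow>
   (('a, 'd) chart \<Rightarrow> 'a \<Rightarrow> real ^ 'd ^ 'd) \<Rightarrow> 'a measure \<Rightarrow>
   (real \<Rightarrow> 'a \<Rightarrow> 'a \<Rightarrow> real) \<Rightarrow> bool" where
  "is_heat_kernel A g V H \<longleftrightarrow>
     (\<forall>c\<in>A. \<forall>c'\<in>A. smooth_on ({0<..} \<times> (snd c ` fst c) \<times> (snd c' ` fst c'))
        (\<lambda>(t :: real, u, w). H t (inv_into (fst c) (snd c) u) (inv_into (fst c') (snd c') w))) \<and>
     (\<exists>T. is_heat_semigroup A g V T \<and>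
        (\<forall>t>0. \<forall>f\<in>L2 V. AE x in V.
           integrable V (\<lambda>y. H t x y * f y) \<and> T t f x = (\<integral>y. H t x y * f y \<partial>V)))"

section \<open>Gaussian random fields\<close>

text \<open>Normal random variables, including the degenerate ones of variance 0.\<close>

definition normal_rv :: "'w measure \<Rightarrow> ('w \<Rightarrow> real) \<Rightarrow> bool" where
  "normal_rv P X \<longleftrightarrow>
     (\<exists>\<mu> \<sigma>. 0 < \<sigma> \<and> distributed P lborel X (\<lambda>x. ennreal (normal_density \<mu> \<sigma> x))) \<or>
     (X \<in> borel_measurable P \<and> (\<exists>\<mu>. AE w in P. X w = \<mu>))"

text \<open>A finite family is jointly normal iff all its linear combinations are normal.\<close>

definition gaussian_random_field :: "'w measure \<Rightarrow> 'i set \<Rightarrow> ('i \<Rightarrow> 'w \<Rightarrow> real) \<Rightarrow> bool" where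
  "gaussian_random_field P I X \<longleftrightarrow> prob_space P \<and> complete_measure P \<and>
     (\<forall>i\<in>I. X i \<in> borel_measurable P) \<and>
     (\<forall>F a. finite F \<and> F \<subseteq> I \<longrightarrow> normal_rv P (\<lambda>w. \<Sum>i\<in>F. a i * X i w))"

definition centered_grf :: "'w measure \<Rightarrow> 'i set \<Rightarrow> ('i \<Rightarrow> 'w \<Rightarrow> real) \<Rightarrow> bool" where
  "centered_grf P I X \<longleftrightarrow> gaussian_random_field P I X \<and> (\<forall>i\<in>I. (\<integral>w. X i w \<partial>P) = 0)"

definition stationary ::
  "('a::topological_space, 'd::finite) chart set \<Rightarrow>
   (('a, 'd) chart \<Rightarrow> 'a \<Rightarrow> real ^ 'd ^ 'd) \<Rightarrow> 'w measure \<Rightarrow> ('a \<Rightarrow> 'w \<Rightarrow> real) \<Rightarrow> bool" where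
  "stationary A g P Y \<longleftrightarrow> centered_grf P UNIV Y \<and>
     (\<forall>\<iota>\<in>isometries A g. \<forall>x y.
        (\<integral>w. Y (\<iota> x) w * Y (\<iota> y) w \<partial>P) = (\<integral>w. Y x w * Y y w \<partial>P))"

definition stationary_increments ::
  "('a::topological_space, 'd::finite) chart set \<Rightarrow>
   (('a, 'd) chart \<Rightarrow> 'a \<Rightarrow> real ^ 'd ^ 'd) \<Rightarrow> 'w measure \<Rightarrow> ('a \<Rightarrow> 'w \<Rightarrow> real) \<Rightarrow> bool" where
  "stationary_increments A g P Y \<longleftrightarrow> centered_grf P UNIV Y \<and>
     (\<forall>\<iota>\<in>isometries A g. \<forall>x y.
        (\<integral>w. \<bar>Y (\<iota> x) w - Y (\<iota> y) w\<bar>\<^sup>2 \<partial>P) = (\<integral>w. \<bar>Y x w - Y y w\<bar>\<^sup>2 \<partial>P))"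

section \<open>Riesz fields\<close>

text \<open>In the following, d is the dimension and H the heat kernel. Convergence of the
  integrals is Lebesgue integrability. When the integral defining \<open>riesz_cov\<close> converges
  for all x and y, it does so absolutely: for \<open>x = y\<close> the integrand is nonnegative, and by the
  Cauchy-Schwarz inequality the general case is dominated by the diagonal one.\<close>

definition riesz_integrand ::
  "nat \<Rightarrow> (real \<Rightarrow> 'a \<Rightarrow> 'a \<Rightarrow> real) \<Rightarrow> 'a \<Rightarrow> real \<Rightarrow> 'a \<Rightarrow> 'a \<Rightarrow> real \<Rightarrow> real" where
  "riesz_integrand d H z \<alpha> x y t =
     t powr (real d / 2 + \<alpha> - 1) * (H t x y - H t x z - H t y z + H t z z)"

definition riesz_exists :: "nat \<Rightarrow> (real \<Rightarrow> 'a \<Rightarrow> 'a \<Rightarrow> real) \<Rightarrow> 'a \<Rightarrow> real \<Rightarrow> bool" where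
  "riesz_exists d H z \<alpha> \<longleftrightarrow>
     (\<forall>x y. set_integrable lborel {0<..} (riesz_integrand d H z \<alpha> x y))"

definition riesz_cov ::
  "nat \<Rightarrow> (real \<Rightarrow> 'a \<Rightarrow> 'a \<Rightarrow> real) \<Rightarrow> 'a \<Rightarrow> real \<Rightarrow> 'a \<Rightarrow> 'a \<Rightarrow> real" where
  "riesz_cov d H z \<alpha> x y =
     1 / Gamma (real d / 2 + \<alpha>) *
     set_lebesgue_integral lborel {0<..} (riesz_integrand d H z \<alpha> x y)"

definition riesz_field ::
  "nat \<Rightarrow> (real \<Rightarrow> 'a \<Rightarrow> 'a \<Rightarrow> real) \<Rightarrow> 'a \<Rightarrow> real \<Rightarrow> 'w measure \<Rightarrow> ('a \<Rightarrow> 'w \<Rightarrow> real) \<Rightarrow> bool" where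
  "riesz_field d H z \<alpha> P R \<longleftrightarrow> centered_grf P UNIV R \<and>
     (\<forall>x y. (\<integral>w. R x w * R y w \<partial>P) = riesz_cov d H z \<alpha> x y)"

definition stat_riesz_integrand ::
  "nat \<Rightarrow> (real \<Rightarrow> 'a \<Rightarrow> 'a \<Rightarrow> real) \<Rightarrow> real \<Rightarrow> 'a \<Rightarrow> 'a \<Rightarrow> real \<Rightarrow> real" where
  "stat_riesz_integrand d H \<alpha> x y t = t powr (real d / 2 + \<alpha> - 1) * H t x y"

definition stat_riesz_exists :: "nat \<Rightarrow> (real \<Rightarrow> 'a \<Rightarrow> 'a \<Rightarrow> real) \<Rightarrow> real \<Rightarrow> bool" where
  "stat_riesz_exists d H \<alpha> \<longleftrightarrow>
     (\<forall>x y. set_integrable lborel {0<..} (stat_riesz_integrand d H \<alpha> x y))"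

definition stat_riesz_cov :: "nat \<Rightarrow> (real \<Rightarrow> 'a \<Rightarrow> 'a \<Rightarrow> real) \<Rightarrow> real \<Rightarrow> 'a \<Rightarrow> 'a \<Rightarrow> real" where
  "stat_riesz_cov d H \<alpha> x y =
     1 / Gamma (real d / 2 + \<alpha>) *
     set_lebesgue_integral lborel {0<..} (stat_riesz_integrand d H \<alpha> x y)"

definition stat_riesz_field ::
  "nat \<Rightarrow> (real \<Rightarrow> 'a \<Rightarrow> 'a \<Rightarrow> real) \<Rightarrow> real \<Rightarrow> 'w measure \<Rightarrow> ('a \<Rightarrow> 'w \<Rightarrow> real) \<Rightarrow> bool" where
  "stat_riesz_field d H \<alpha> P hR \<longleftrightarrow> centered_grf P UNIV hR \<and>
     (\<forall>x y. (\<integral>w. hR x w * hR y w \<partial>P) = stat_riesz_cov d H \<alpha> x y)"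

end

theory Submission
  imports Defs
begin

text \<open>Everything reduces to the invariance \<open>H t (i x) (i y) = H t x y\<close> of the heat kernel under
  an isometry i. Transporting a chart by i gives a chart of the maximal atlas in which the metric
  has the same coefficients, so i preserves the measure and commutes with the Laplacian on test
  functions. Conjugating the heat semigroup by i therefore yields a contraction semigroup whose
  generator is again a self-adjoint extension of that operator; by uniqueness of the extension the
  generators, hence the semigroups, coincide. Continuity of the kernels and full support of the
  measure turn this into a pointwise identity. In the variance of an increment of the Riesz field
  all terms containing the origin cancel.\<close>

section \<open>Contraction semigroups on L2\<close>

text \<open>Elements of L2 are plain functions, so the semigroup laws and the kernel representation
  hold only almost everywhere, with exceptional sets that vary with time and function. The
  comparison of two semigroups is therefore carried by one real function of time, the norm of the
  difference of two orbits: it is continuous and its right increments are at most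
  \<open>o(r)\<close>, so it cannot leave 0. Density of the generator domain then passes from orbits
  in the domain to all of L2. Conjugation is harmless on the operator side because composition with
  \<open>i\<close> is unitary. That rests on invariance of the measure, which is prescribed only on
  Borel sets inside single charts and has to be assembled from a countable cover. For the
  generators, only the inclusion of the test pairs in the conjugated graph is checked; the equality
  comes from the uniqueness clause of \<open>is_laplacian\<close>, without any approximation by test
  functions.\<close>

lemma L2_lincomb:
  assumes "f \<in> L2 V" "h \<in> L2 V"
  shows "(\<lambda>x. a * f x + b * h x) \<in> L2 V"
proof -
  have [measurable]: "f \<in> borel_measurable V" "h \<in> borel_measurable V"
    using assms by (auto simp: L2_def)
  have i: "integrable V (\<lambda>x. 2 * a\<^sup>2 * (f x)\<^sup>2 + 2 * b\<^sup>2 * (h x)\<^sup>2)"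
    using assms by (auto simp: L2_def)
  have "integrable V (\<lambda>x. (a * f x + b * h x)\<^sup>2)"
  proof (rule Bochner_Integration.integrable_bound[OF i])
    have "(a * f x + b * h x)\<^sup>2 \<le> 2 * a\<^sup>2 * (f x)\<^sup>2 + 2 * b\<^sup>2 * (h x)\<^sup>2" for x
      using zero_le_power2[of "a * f x - b * h x"] by (simp add: power2_eq_square algebra_simps)
    thus "AE x in V. norm ((a * f x + b * h x)\<^sup>2) \<le> norm (2 * a\<^sup>2 * (f x)\<^sup>2 + 2 * b\<^sup>2 * (h x)\<^sup>2)"
      by (auto intro!: AE_I2 order_trans[OF _ abs_ge_self])
  qed simp
  thus ?thesis by (simp add: L2_def)
qed

lemma L2_add: "f \<in> L2 V \<Longrightarrow> h \<in> L2 V \<Longrightarrow> (\<lambda>x. f x + h x) \<in> L2 V"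
  using L2_lincomb[of f V h 1 1] by simp

lemma L2_diff: "f \<in> L2 V \<Longrightarrow> h \<in> L2 V \<Longrightarrow> (\<lambda>x. f x - h x) \<in> L2 V"
  using L2_lincomb[of f V h 1 "-1"] by simp

lemma L2_divide: "f \<in> L2 V \<Longrightarrow> (\<lambda>x. f x / t) \<in> L2 V"
  using L2_lincomb[of f V f "1/t" 0] by simp

section \<open>The L2 seminorm\<close>

lemma L2_norm_altdef: "L2_norm V f = sqrt (\<integral>x. (f x)\<^sup>2 \<partial>V)"
  by (simp add: L2_norm_def L2_inner_def power2_eq_square)

lemma L2_norm_nonneg: "0 \<le> L2_norm V f"
  by (simp add: L2_norm_altdef)

lemma L2_norm_minus: "L2_norm V (\<lambda>x. f x - h x) = L2_norm V (\<lambda>x. h x - f x)"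
  by (simp add: L2_norm_altdef power2_commute)

lemma L2_norm_divide: "L2_norm V (\<lambda>x. f x / t) = L2_norm V f / \<bar>t\<bar>"
  by (simp add: L2_norm_altdef power_divide real_sqrt_divide)

lemma L2_norm_cong_AE:
  assumes "f \<in> L2 V" "h \<in> L2 V" "AE x in V. f x = h x"
  shows "L2_norm V f = L2_norm V h"
proof -
  have [measurable]: "f \<in> borel_measurable V" "h \<in> borel_measurable V"
    using assms by (auto simp: L2_def)
  have "(\<integral>x. (f x)\<^sup>2 \<partial>V) = (\<integral>x. (h x)\<^sup>2 \<partial>V)"
    by (rule integral_cong_AE) (use assms(3) in auto)
  thus ?thesis by (simp add: L2_norm_altdef)
qed

lemma L2_norm_zero_iff:
  assumes "f \<in> L2 V"
  shows "L2_norm V f = 0 \<longleftrightarrow> (AE x in V. f x = 0)"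
  using assms integral_nonneg_eq_0_iff_AE[of V "\<lambda>x. (f x)\<^sup>2"]
  by (simp add: L2_norm_altdef L2_def)

text \<open>Integrating the weighted inequality
  \<open>(a + b)^2 <= (1 + e) a^2 + (1 + 1/e) b^2\<close> and optimising over \<open>e\<close> gives
  the claim directly. The optimal weight is a quotient of the two norms, so a vanishing norm is a
  separate case, in which one summand is zero almost everywhere.\<close>

lemma L2_norm_triangle:
  assumes "f \<in> L2 V" "h \<in> L2 V"
  shows "L2_norm V (\<lambda>x. f x + h x) \<le> L2_norm V f + L2_norm V h"
proof -
  have i: "integrable V (\<lambda>x. (f x)\<^sup>2)" "integrable V (\<lambda>x. (h x)\<^sup>2)"
       "integrable V (\<lambda>x. (f x + h x)\<^sup>2)"
    using assms L2_add[OF assms] by (auto simp: L2_def)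
  have sq: "(L2_norm V k)\<^sup>2 = (\<integral>x. (k x)\<^sup>2 \<partial>V)" for k
    by (simp add: L2_norm_altdef)
  let ?F = "L2_norm V f" and ?H = "L2_norm V h"
  have main: "(L2_norm V (\<lambda>x. f x + h x))\<^sup>2 \<le> (1 + e) * ?F\<^sup>2 + (1 + 1 / e) * ?H\<^sup>2" if "e > 0" for e
  proof -
    have "(f x + h x)\<^sup>2 \<le> (1 + e) * (f x)\<^sup>2 + (1 + 1 / e) * (h x)\<^sup>2" for x
    proof -
      have "0 \<le> (e * f x - h x)\<^sup>2 / e" using that by simp
      also have "\<dots> = (1 + e) * (f x)\<^sup>2 + (1 + 1 / e) * (h x)\<^sup>2 - (f x + h x)\<^sup>2"
        using that by (simp add: power2_eq_square field_simps)
      finally show ?thesis by simp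
    qed
    hence "(\<integral>x. (f x + h x)\<^sup>2 \<partial>V) \<le> (\<integral>x. (1 + e) * (f x)\<^sup>2 + (1 + 1 / e) * (h x)\<^sup>2 \<partial>V)"
      by (intro integral_mono) (use i in auto)
    also have "\<dots> = (1 + e) * (\<integral>x. (f x)\<^sup>2 \<partial>V) + (1 + 1 / e) * (\<integral>x. (h x)\<^sup>2 \<partial>V)"
      using i by simp
    finally show ?thesis by (simp add: sq)
  qed
  have nn: "0 \<le> ?F" "0 \<le> ?H" by (rule L2_norm_nonneg)+
  show ?thesis
  proof (cases "?F = 0 \<or> ?H = 0")
    case False
    hence p: "?F > 0" "?H > 0" using nn by auto
    \<comment> \<open>The weight \<open>e = ?H / ?F\<close> makes both correction terms equal to
      \<open>?F * ?H\<close>.\<close>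
    have "(L2_norm V (\<lambda>x. f x + h x))\<^sup>2 \<le> (1 + ?H / ?F) * ?F\<^sup>2 + (1 + 1 / (?H / ?F)) * ?H\<^sup>2"
      by (rule main) (use p in simp)
    also have "\<dots> = (?F + ?H)\<^sup>2"
    proof -
      have "(1 + b / a) * a\<^sup>2 + (1 + 1 / (b / a)) * b\<^sup>2 = (a + b)\<^sup>2" if "0 < a" "0 < b" for a b :: real
        using that by (simp add: power2_eq_square algebra_simps)
      thus ?thesis using p by blast
    qed
    finally show ?thesis using nn by (auto intro: power2_le_imp_le)
  next
    case True
    thus ?thesis
    proof
      assume "?F = 0"
      hence "AE x in V. f x = 0" by (rule L2_norm_zero_iff[OF assms(1), THEN iffD1])
      hence "L2_norm V (\<lambda>x. f x + h x) = ?H"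
        by (intro L2_norm_cong_AE L2_add assms) auto
      thus ?thesis using nn by simp
    next
      assume "?H = 0"
      hence "AE x in V. h x = 0" by (rule L2_norm_zero_iff[OF assms(2), THEN iffD1])
      hence "L2_norm V (\<lambda>x. f x + h x) = ?F"
        by (intro L2_norm_cong_AE L2_add assms) auto
      thus ?thesis using nn by simp
    qed
  qed
qed

lemma L2_norm_triangle_diff:
  assumes "f \<in> L2 V" "h \<in> L2 V" "k \<in> L2 V"
  shows "L2_norm V (\<lambda>x. f x - k x) \<le> L2_norm V (\<lambda>x. f x - h x) + L2_norm V (\<lambda>x. h x - k x)"
  using L2_norm_triangle[OF L2_diff[OF assms(1,2)] L2_diff[OF assms(2,3)]] by simp

context
  fixes V :: "'a measure" and T
  assumes T: "L2_contraction V T"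
begin

lemma L2_contraction_mem: "f \<in> L2 V \<Longrightarrow> T f \<in> L2 V"
  using T by (simp add: L2_contraction_def)

lemma L2_contraction_diff:
  assumes "f \<in> L2 V" "h \<in> L2 V"
  shows "AE x in V. T (\<lambda>y. f y - h y) x = T f x - T h x"
proof -
  have "AE x in V. T (\<lambda>y. 1 * f y + (-1) * h y) x = 1 * T f x + (-1) * T h x"
    using T assms unfolding L2_contraction_def by blast
  thus ?thesis by simp
qed

lemma L2_contraction_norm_diff:
  assumes "f \<in> L2 V" "h \<in> L2 V"
  shows "L2_norm V (\<lambda>x. T f x - T h x) \<le> L2_norm V (\<lambda>x. f x - h x)"
proof -
  have "L2_norm V (\<lambda>x. T f x - T h x) = L2_norm V (T (\<lambda>x. f x - h x))"
    using L2_contraction_diff[OF assms]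
    by (intro L2_norm_cong_AE L2_diff L2_contraction_mem assms) auto
  also have "\<dots> \<le> L2_norm V (\<lambda>x. f x - h x)"
    using T L2_diff[OF assms] by (simp add: L2_contraction_def)
  finally show ?thesis .
qed

text \<open>Linearity is available only as an almost everywhere statement for two-term combinations,
  so it is applied twice to reach the expression inside \<open>generator\<close>.\<close>

lemma L2_contraction_difference_quotient:
  assumes "f \<in> L2 V" "h \<in> L2 V" "k \<in> L2 V"
  shows "AE x in V. T (\<lambda>y. (f y - h y) / r - k y) x = (T f x - T h x) / r - T k x"
proof -
  have *: "AE x in V. T (\<lambda>y. (1/r) * (f y - h y) + (-1) * k y) x
      = (1/r) * T (\<lambda>y. f y - h y) x + (-1) * T k x"
    using T[unfolded L2_contraction_def, THEN conjunct2, THEN conjunct1, THEN bspec,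
        OF L2_diff[OF assms(1,2)], THEN bspec, OF assms(3)] by (elim allE)
  have eq: "(\<lambda>y. (1/r) * (f y - h y) + (-1) * k y) = (\<lambda>y. (f y - h y) / r - k y)"
    by (simp add: fun_eq_iff)
  show ?thesis using *[unfolded eq] L2_contraction_diff[OF assms(1,2)]
    by eventually_elim simp
qed

end

section \<open>Semigroups and their generators\<close>

lemma contraction_semigroupD:
  assumes "contraction_semigroup V T"
  shows "0 \<le> t \<Longrightarrow> L2_contraction V (T t)"
    and "f \<in> L2 V \<Longrightarrow> AE x in V. T 0 f x = f x"
    and "0 \<le> s \<Longrightarrow> 0 \<le> t \<Longrightarrow> f \<in> L2 V \<Longrightarrow> AE x in V. T (s + t) f x = T s (T t f) x"
    and "f \<in> L2 V \<Longrightarrow> ((\<lambda>t. L2_norm V (\<lambda>x. T t f x - f x)) \<longlongrightarrow> 0) (at_right 0)"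
  using assms by (auto simp: contraction_semigroup_def)

lemma contraction_semigroup_mem:
  "contraction_semigroup V T \<Longrightarrow> 0 \<le> t \<Longrightarrow> f \<in> L2 V \<Longrightarrow> T t f \<in> L2 V"
  by (meson L2_contraction_mem contraction_semigroupD(1))

lemma contraction_semigroup_commute:
  assumes "contraction_semigroup V T" "0 \<le> s" "0 \<le> t" "f \<in> L2 V"
  shows "AE x in V. T s (T t f) x = T t (T s f) x"
proof -
  note D = contraction_semigroupD(3)[OF assms(1)]
  have "AE x in V. T (s + t) f x = T s (T t f) x" "AE x in V. T (s + t) f x = T t (T s f) x"
    using D[of s t f] D[of t s f] assms by (auto simp: add.commute)
  thus ?thesis by eventually_elim simp
qed

text \<open>Since \<open>T r\<close> and \<open>T t\<close> commute, the error of the difference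
  quotient for \<open>T t f\<close> is \<open>T t\<close> applied to the error for \<open>f\<close>,
  and a contraction does not enlarge it.\<close>

lemma generator_invariant:
  assumes sg: "contraction_semigroup V T" and G: "(f, h) \<in> generator V T" and t: "0 \<le> t"
  shows "(T t f, T t h) \<in> generator V T"
proof -
  have f: "f \<in> L2 V" and h: "h \<in> L2 V"
    and lim: "((\<lambda>r. L2_norm V (\<lambda>x. (T r f x - f x) / r - h x)) \<longlongrightarrow> 0) (at_right 0)"
    using G by (auto simp: generator_def)
  note mem = contraction_semigroup_mem[OF sg]
  have le: "L2_norm V (\<lambda>x. (T r (T t f) x - T t f x) / r - T t h x)
       \<le> L2_norm V (\<lambda>x. (T r f x - f x) / r - h x)" if r: "0 < r" for r
  proof -
    have q: "(\<lambda>x. (T r f x - f x) / r - h x) \<in> L2 V"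
      using r by (intro L2_diff L2_divide mem f h) auto
    note C = contraction_semigroupD(1)[OF sg t]
    have "AE x in V. T t (\<lambda>x. (T r f x - f x) / r - h x) x = (T t (T r f) x - T t f x) / r - T t h x"
      using r by (intro L2_contraction_difference_quotient C mem f h) auto
    moreover have "AE x in V. T r (T t f) x = T t (T r f) x"
      using r t by (intro contraction_semigroup_commute[OF sg] f) auto
    ultimately have "AE x in V. (T r (T t f) x - T t f x) / r - T t h x
         = T t (\<lambda>x. (T r f x - f x) / r - h x) x"
      by eventually_elim simp
    hence "L2_norm V (\<lambda>x. (T r (T t f) x - T t f x) / r - T t h x)
         = L2_norm V (T t (\<lambda>x. (T r f x - f x) / r - h x))"
      using r t by (intro L2_norm_cong_AE L2_diff L2_divide mem f h q) auto
    also have "\<dots> \<le> L2_norm V (\<lambda>x. (T r f x - f x) / r - h x)"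
      using C q by (simp add: L2_contraction_def)
    finally show ?thesis .
  qed
  have "((\<lambda>r. L2_norm V (\<lambda>x. (T r (T t f) x - T t f x) / r - T t h x)) \<longlongrightarrow> 0) (at_right 0)"
    by (rule tendsto_sandwich[OF _ _ tendsto_const lim])
       (auto simp: L2_norm_nonneg eventually_at_right_less intro!: le eventually_mono[OF eventually_at_right_less])
  thus ?thesis using mem[OF t f] mem[OF t h] by (simp add: generator_def)
qed

text \<open>Continuous induction: for each slope \<open>e > 0\<close> the largest time in
  \<open>{0..b}\<close> at which \<open>u t \<le> e * t\<close> must be \<open>b\<close>, because
  the increment bound with the same slope would carry the inequality a little further to the right.
  Only right increments enter, which is what a semigroup controls.\<close>

lemma nonpos_of_small_right_increments:
  fixes u :: "real \<Rightarrow> real"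
  assumes cont: "continuous_on {0..} u" and zero: "u 0 \<le> 0"
    and incr: "\<And>t e. 0 \<le> t \<Longrightarrow> 0 < e \<Longrightarrow> eventually (\<lambda>r. u (t + r) \<le> u t + e * r) (at_right 0)"
    and b: "0 \<le> b"
  shows "u b \<le> 0"
proof (rule field_le_epsilon)
  fix e' :: real assume e': "0 < e'"
  \<comment> \<open>The denominator \<open>b + 1\<close> keeps \<open>e\<close> positive and well
    defined when \<open>b = 0\<close>.\<close>
  define e where "e = e' / (b + 1)"
  have e: "0 < e" using e' b by (simp add: e_def)
  define E where "E = {t \<in> {0..b}. u t \<le> e * t}"
  have "compact E"
  proof -
    have "E = {0..b} \<inter> (\<lambda>t. u t - e * t) -` {..0}" by (auto simp: E_def)
    moreover have "continuous_on {0..b} (\<lambda>t. u t - e * t)"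
      by (intro continuous_intros continuous_on_subset[OF cont]) auto
    ultimately have "closed E" by (auto intro!: continuous_closed_preimage)
    moreover have "bounded E" by (rule bounded_subset[of "{0..b}"]) (auto simp: E_def)
    ultimately show ?thesis by (simp add: compact_eq_bounded_closed)
  qed
  moreover have "0 \<in> E" using zero b by (simp add: E_def)
  ultimately obtain s where s: "s \<in> E" "\<And>t. t \<in> E \<Longrightarrow> t \<le> s"
    using compact_attains_sup[of E] by (metis empty_iff)
  have "s = b"
  proof (rule ccontr)
    assume "s \<noteq> b"
    hence sb: "0 \<le> s" "s < b" "u s \<le> e * s" using s(1) by (auto simp: E_def)
    have "eventually (\<lambda>r. u (s + r) \<le> u s + e * r \<and> 0 < r \<and> r < b - s) (at_right 0)"
      by (rule eventually_mono[OF eventually_conj[OF incr[OF sb(1) e] eventually_at_right_real[of 0 "b - s"]]])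
         (use sb(2) in auto)
    then obtain r where r: "u (s + r) \<le> u s + e * r" "0 < r" "r < b - s"
      using eventually_happens'[OF trivial_limit_at_right_real] by blast
    have "s + r \<in> E" using r sb by (auto simp: E_def algebra_simps)
    with s(2) r(2) show False by fastforce
  qed
  hence "u b \<le> e * b" using s(1) by (simp add: E_def)
  also have "\<dots> \<le> e'" using e' b by (simp add: e_def field_simps)
  finally show "u b \<le> 0 + e'" by simp
qed

text \<open>On the common domain of the generators, the norm of \<open>T t u - S t u\<close> grows over the time
  interval from t to \<open>t + r\<close> by at most the norm of \<open>T r v - S r v\<close> where \<open>v = S t u\<close>. This is
  \<open>o(r)\<close> because v lies in that domain again.\<close>

theorem contraction_semigroup_eq_of_generator_eq:
  assumes T: "contraction_semigroup V T" and S: "contraction_semigroup V S"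
    and gen: "generator V T = generator V S"
    and dense: "\<And>f e. f \<in> L2 V \<Longrightarrow> 0 < e \<Longrightarrow>
      \<exists>(u, w)\<in>generator V T. L2_norm V (\<lambda>x. f x - u x) < e"
    and t: "0 \<le> t" and f: "f \<in> L2 V"
  shows "AE x in V. T t f x = S t f x"
proof -
  note memT = contraction_semigroup_mem[OF T] and memS = contraction_semigroup_mem[OF S]
  have on_generator: "L2_norm V (\<lambda>x. T b u x - S b u x) \<le> 0"
    if G: "(u, w) \<in> generator V T" and b: "0 \<le> b" for u w b
  proof -
    have u: "u \<in> L2 V" using G by (simp add: generator_def)
    define \<phi> where "\<phi> s = L2_norm V (\<lambda>x. T s u x - S s u x)" for s
    \<comment> \<open>\<open>\<psi> r\<close> will bound the change of \<open>\<phi>\<close> over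
      any interval of length \<open>r\<close>, uniformly in its starting point: a contraction moves
      an orbit no further over that length than it moves from time 0.\<close>
    define \<psi> where "\<psi> r = L2_norm V (\<lambda>x. T r u x - u x) + L2_norm V (\<lambda>x. S r u x - u x)" for r
    have \<psi>: "(\<psi> \<longlongrightarrow> 0) (at_right 0)"
      unfolding \<psi>_def using tendsto_add[OF contraction_semigroupD(4)[OF T u] contraction_semigroupD(4)[OF S u]]
      by simp
    have osc: "L2_norm V (\<lambda>x. U (s + r) u x - U s u x) \<le> L2_norm V (\<lambda>x. U r u x - u x)"
      if U: "contraction_semigroup V U" and "0 \<le> s" "0 \<le> r" for U s r
    proof -
      note mem = contraction_semigroup_mem[OF U]
      have "AE x in V. U (s + r) u x = U s (U r u) x"
        by (rule contraction_semigroupD(3)[OF U that(2,3) u])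
      hence "L2_norm V (\<lambda>x. U (s + r) u x - U s u x) = L2_norm V (\<lambda>x. U s (U r u) x - U s u x)"
        using that(2,3) by (intro L2_norm_cong_AE L2_diff mem u) auto
      also have "\<dots> \<le> L2_norm V (\<lambda>x. U r u x - u x)"
        using that(2,3) by (intro L2_contraction_norm_diff contraction_semigroupD(1)[OF U] mem u)
      finally show ?thesis .
    qed
    have \<phi>_close: "\<bar>\<phi> (s + r) - \<phi> s\<bar> \<le> \<psi> r" if sr: "0 \<le> s" "0 \<le> r" for s r
    proof -
      have m: "T (s + r) u \<in> L2 V" "S (s + r) u \<in> L2 V" "T s u \<in> L2 V" "S s u \<in> L2 V"
        using sr by (auto intro!: memT memS u)
      have "\<phi> (s + r) \<le> L2_norm V (\<lambda>x. T (s + r) u x - T s u x) + \<phi> s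
               + L2_norm V (\<lambda>x. S s u x - S (s + r) u x)"
        unfolding \<phi>_def
        using L2_norm_triangle_diff[OF m(1,3,2)] L2_norm_triangle_diff[OF m(3,4,2)] by linarith
      moreover have "\<phi> s \<le> L2_norm V (\<lambda>x. T s u x - T (s + r) u x) + \<phi> (s + r)
               + L2_norm V (\<lambda>x. S (s + r) u x - S s u x)"
        unfolding \<phi>_def
        using L2_norm_triangle_diff[OF m(3,1,4)] L2_norm_triangle_diff[OF m(1,2,4)] by linarith
      ultimately show ?thesis
        using osc[OF T sr] osc[OF S sr] L2_norm_minus[of V "T s u" "T (s + r) u"]
          L2_norm_minus[of V "S s u" "S (s + r) u"]
        unfolding \<psi>_def by linarith
    qed
    have "\<phi> b \<le> 0"
    proof (rule nonpos_of_small_right_increments[OF _ _ _ b])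
      show "continuous_on {0..} \<phi>"
        unfolding continuous_on_iff
      proof safe
        fix s e :: real assume s: "0 \<le> s" and e: "0 < e"
        have "eventually (\<lambda>r. \<psi> r < e) (at_right 0)" using \<psi> e by (rule order_tendstoD(2))
        then obtain d where d: "d > 0" "\<And>r. 0 < r \<Longrightarrow> r < d \<Longrightarrow> \<psi> r < e"
          by (auto simp: eventually_at_right_field)
        show "\<exists>d>0. \<forall>r\<in>{0..}. dist r s < d \<longrightarrow> dist (\<phi> r) (\<phi> s) < e"
        proof (intro exI[of _ d] conjI ballI impI)
          fix r assume r: "r \<in> {0..}" "dist r s < d"
          consider "r = s" | "s < r" | "r < s" by linarith
          thus "dist (\<phi> r) (\<phi> s) < e"
          proof cases
            case 2
            with \<phi>_close[of s "r - s"] d(2)[of "r - s"] r s show ?thesis by (simp add: dist_real_def)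
          next
            case 3
            with \<phi>_close[of r "s - r"] d(2)[of "s - r"] r s show ?thesis by (simp add: dist_real_def)
          qed (use e in simp)
        qed (rule d)
      qed
    next
      have "AE x in V. T 0 u x = u x" "AE x in V. S 0 u x = u x"
        using T S u by (auto intro: contraction_semigroupD(2))
      hence "AE x in V. T 0 u x - S 0 u x = 0" by eventually_elim simp
      hence "\<phi> 0 = 0" unfolding \<phi>_def
        by (subst L2_norm_zero_iff) (auto intro!: L2_diff memT memS u)
      thus "\<phi> 0 \<le> 0" by simp
    next
      fix s e :: real assume s: "0 \<le> s" and e: "0 < e"
      define v where "v = S s u"
      \<comment> \<open>As the generators agree, this one \<open>k\<close> is the derivative at 0 of
        both orbits starting at \<open>v\<close>; it cancels in the difference of the two quotients
        below.\<close>
      define k where "k = S s w"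
      have vk: "(v, k) \<in> generator V S" unfolding v_def k_def
        using generator_invariant[OF S _ s] G gen by blast
      have v: "v \<in> L2 V" and k: "k \<in> L2 V" using vk by (auto simp: generator_def)
      have "((\<lambda>r. L2_norm V (\<lambda>x. (T r v x - v x) / r - k x)
              + L2_norm V (\<lambda>x. (S r v x - v x) / r - k x)) \<longlongrightarrow> 0 + 0) (at_right 0)"
        using vk gen by (intro tendsto_add) (auto simp: generator_def)
      hence "eventually (\<lambda>r. L2_norm V (\<lambda>x. (T r v x - v x) / r - k x)
              + L2_norm V (\<lambda>x. (S r v x - v x) / r - k x) < e) (at_right 0)"
        using e by (intro order_tendstoD(2)[where y = 0]) auto
      thus "eventually (\<lambda>r. \<phi> (s + r) \<le> \<phi> s + e * r) (at_right 0)"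
        using eventually_at_right_less
      proof eventually_elim
        case (elim r)
        hence r: "0 < r" by simp
        have m: "T r v \<in> L2 V" "S r v \<in> L2 V" "T s u \<in> L2 V" "T r (T s u) \<in> L2 V"
          using r s by (auto intro!: memT memS u v)
        have "L2_norm V (\<lambda>x. (T r v x - S r v x) / r)
            = L2_norm V (\<lambda>x. ((T r v x - v x) / r - k x) - ((S r v x - v x) / r - k x))"
          by (simp add: diff_divide_distrib)
        \<comment> \<open>The zero function is the middle point of the triangle inequality; the
          combination with coefficients 0 and 0 puts it into L2.\<close>
        also have "\<dots> \<le> L2_norm V (\<lambda>x. (T r v x - v x) / r - k x - 0)
              + L2_norm V (\<lambda>x. 0 - ((S r v x - v x) / r - k x))"
          by (rule L2_norm_triangle_diff) (use L2_lincomb[OF v v, of 0 0] in \<open>auto intro!: L2_diff L2_divide m v k\<close>)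
        also have "\<dots> < e" using elim(1) L2_norm_minus[of V "\<lambda>_. 0" "\<lambda>x. (S r v x - v x) / r - k x"]
          by (simp only: diff_0_right)
        finally have small: "L2_norm V (\<lambda>x. T r v x - S r v x) \<le> e * r"
          using r by (simp add: L2_norm_divide field_simps)
        have "AE x in V. T (s + r) u x = T r (T s u) x" "AE x in V. S (s + r) u x = S r v x"
          using contraction_semigroupD(3)[OF T, of r s u] contraction_semigroupD(3)[OF S, of r s u] r s u
          by (simp_all add: v_def add.commute)
        hence "\<phi> (s + r) = L2_norm V (\<lambda>x. T r (T s u) x - S r v x)"
          unfolding \<phi>_def using r s by (intro L2_norm_cong_AE L2_diff m memT memS u) auto
        also have "\<dots> \<le> L2_norm V (\<lambda>x. T r (T s u) x - T r v x) + L2_norm V (\<lambda>x. T r v x - S r v x)"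
          by (intro L2_norm_triangle_diff m)
        also have "L2_norm V (\<lambda>x. T r (T s u) x - T r v x) \<le> \<phi> s"
          unfolding \<phi>_def v_def[symmetric] using r
          by (intro L2_contraction_norm_diff contraction_semigroupD(1)[OF T] m v) auto
        finally show ?case using small by simp
      qed
    qed
    thus ?thesis unfolding \<phi>_def .
  qed
  have "L2_norm V (\<lambda>x. T t f x - S t f x) \<le> 0"
  proof (rule field_le_epsilon)
    fix e :: real assume "0 < e"
    \<comment> \<open>The approximation error enters once for each semigroup, hence
      \<open>e / 2\<close>.\<close>
    then obtain u w where uw: "(u, w) \<in> generator V T" "L2_norm V (\<lambda>x. f x - u x) < e / 2"
      using dense[OF f, of "e / 2"] by auto
    have u: "u \<in> L2 V" using uw by (simp add: generator_def)
    have m: "T t f \<in> L2 V" "S t f \<in> L2 V" "T t u \<in> L2 V" "S t u \<in> L2 V"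
      using t by (auto intro!: memT memS u f)
    have "L2_norm V (\<lambda>x. T t f x - T t u x) \<le> L2_norm V (\<lambda>x. f x - u x)"
      "L2_norm V (\<lambda>x. S t u x - S t f x) \<le> L2_norm V (\<lambda>x. u x - f x)"
      by (intro L2_contraction_norm_diff contraction_semigroupD(1)[OF T] contraction_semigroupD(1)[OF S] t f u)+
    thus "L2_norm V (\<lambda>x. T t f x - S t f x) \<le> 0 + e"
      using L2_norm_triangle_diff[OF m(1,3,2)] L2_norm_triangle_diff[OF m(3,4,2)]
        on_generator[OF uw(1) t] uw(2) L2_norm_minus[of V u f] by linarith
  qed
  hence "L2_norm V (\<lambda>x. T t f x - S t f x) = 0" using L2_norm_nonneg by (rule order_antisym)
  moreover have "(\<lambda>x. T t f x - S t f x) \<in> L2 V" by (intro L2_diff memT memS f t)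
  ultimately show ?thesis by (simp add: L2_norm_zero_iff)
qed

section \<open>Conjugation by automorphisms of the measure\<close>

text \<open>Invariance is phrased as an equality of push-forwards so that the transfer rules for
  \<open>distr\<close> apply. Measurability of \<open>inv i\<close> is demanded separately to make
  the notion stable under inversion.\<close>

definition measure_automorphism :: "'a measure \<Rightarrow> ('a \<Rightarrow> 'a) \<Rightarrow> bool" where
  "measure_automorphism V i \<longleftrightarrow> bij i \<and> i \<in> measurable V V \<and> inv i \<in> measurable V V \<and> distr V V i = V"

lemma measure_automorphism_inv:
  assumes "measure_automorphism V i"
  shows "measure_automorphism V (inv i)"
proof -
  have i: "bij i" "i \<in> measurable V V" "inv i \<in> measurable V V" "distr V V i = V"
    using assms by (auto simp: measure_automorphism_def)
  have "distr V V (inv i) = distr (distr V V i) V (inv i)" using i(4) by simp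
  also have "\<dots> = distr V V (inv i \<circ> i)" using i by (intro distr_distr) auto
  also have "\<dots> = V" using i(1) by (simp add: bij_is_inj id_def)
  finally show ?thesis
    using i by (simp add: measure_automorphism_def bij_imp_bij_inv inv_inv_eq)
qed

context
  fixes V :: "'a measure" and i :: "'a \<Rightarrow> 'a"
  assumes i: "measure_automorphism V i"
begin

lemma measure_automorphism_measurable: "i \<in> measurable V V"
  using i by (simp add: measure_automorphism_def)

lemma measure_automorphism_distr: "distr V V i = V"
  using i by (simp add: measure_automorphism_def)

lemma measure_automorphism_inverse: "i (inv i x) = x" "inv i (i x) = x"
  using i by (auto simp: measure_automorphism_def bij_is_inj bij_is_surj surj_f_inv_f)

lemma integrable_automorphism:
  "integrable V f \<Longrightarrow> integrable V (\<lambda>x. f (i x) :: real)"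
  by (rule integrable_distr[OF measure_automorphism_measurable]) (simp add: measure_automorphism_distr)

lemma integral_automorphism:
  "f \<in> borel_measurable V \<Longrightarrow> (\<integral>x. f (i x) \<partial>V) = (\<integral>x. f x \<partial>V :: real)"
  using integral_distr[OF measure_automorphism_measurable, of f] by (simp add: measure_automorphism_distr)

lemma AE_automorphism: "AE x in V. P x \<Longrightarrow> AE x in V. P (i x)"
  by (rule AE_distrD[OF measure_automorphism_measurable], subst measure_automorphism_distr)

lemma L2_automorphism: "f \<in> L2 V \<Longrightarrow> (\<lambda>x. f (i x)) \<in> L2 V"
  using integrable_automorphism[of "\<lambda>x. (f x)\<^sup>2"] measurable_compose[OF measure_automorphism_measurable, of f]
  by (auto simp: L2_def)

lemma L2_inner_automorphism:
  "f \<in> L2 V \<Longrightarrow> h \<in> L2 V \<Longrightarrow> L2_inner V (\<lambda>x. f (i x)) (\<lambda>x. h (i x)) = L2_inner V f h"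
  unfolding L2_inner_def by (rule integral_automorphism) (auto simp: L2_def)

lemma L2_norm_automorphism: "f \<in> L2 V \<Longrightarrow> L2_norm V (\<lambda>x. f (i x)) = L2_norm V f"
  unfolding L2_norm_def by (simp add: L2_inner_automorphism)

end

lemma L2_automorphism_iff:
  assumes "measure_automorphism V i"
  shows "(\<lambda>x. f (i x)) \<in> L2 V \<longleftrightarrow> f \<in> L2 V"
proof
  assume "(\<lambda>x. f (i x)) \<in> L2 V"
  from L2_automorphism[OF measure_automorphism_inv[OF assms] this]
  show "f \<in> L2 V" by (simp add: measure_automorphism_inverse[OF assms])
qed (rule L2_automorphism[OF assms])

text \<open>With the unitary operator \<open>U f = f o inv i\<close>, this is
  \<open>U T(t) U^-1\<close>.\<close>

definition conjugate_semigroup ::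
  "('a \<Rightarrow> 'a) \<Rightarrow> (real \<Rightarrow> ('a \<Rightarrow> real) \<Rightarrow> 'a \<Rightarrow> real) \<Rightarrow> real \<Rightarrow> ('a \<Rightarrow> real) \<Rightarrow> 'a \<Rightarrow> real" where
  "conjugate_semigroup i T t f = (\<lambda>x. T t (\<lambda>y. f (i y)) (inv i x))"

text \<open>The graph of the operator conjugated by the same \<open>U\<close>: a pair belongs to it
  when its pull-back by \<open>i\<close> belongs to \<open>D\<close>.\<close>

definition conjugate_graph ::
  "('a \<Rightarrow> 'a) \<Rightarrow> (('a \<Rightarrow> real) \<times> ('a \<Rightarrow> real)) set \<Rightarrow> (('a \<Rightarrow> real) \<times> ('a \<Rightarrow> real)) set" where
  "conjugate_graph i D = {(f, h). ((\<lambda>x. f (i x)), (\<lambda>x. h (i x))) \<in> D}"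

context
  fixes V :: "'a measure" and i :: "'a \<Rightarrow> 'a"
  assumes i: "measure_automorphism V i"
begin

lemmas inverse_simps = measure_automorphism_inverse[OF i]
lemmas L2_pull = L2_automorphism[OF i] and L2_push = L2_automorphism[OF measure_automorphism_inv[OF i]]
lemmas norm_pull = L2_norm_automorphism[OF i] and norm_push = L2_norm_automorphism[OF measure_automorphism_inv[OF i]]

lemma conjugate_semigroup_norm_diff:
  assumes "contraction_semigroup V T" "f \<in> L2 V" "h \<in> L2 V" "0 \<le> t"
  shows "L2_norm V (\<lambda>x. (conjugate_semigroup i T t f x - f x) / r - h x)
       = L2_norm V (\<lambda>x. (T t (\<lambda>y. f (i y)) x - f (i x)) / r - h (i x))"
proof -
  have "(\<lambda>x. (T t (\<lambda>y. f (i y)) x - f (i x)) / r - h (i x)) \<in> L2 V"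
    by (intro L2_diff L2_divide contraction_semigroup_mem[OF assms(1)] L2_pull assms)
  from norm_push[OF this] show ?thesis
    by (simp add: conjugate_semigroup_def inverse_simps)
qed

text \<open>Composition with \<open>i\<close> preserves norms, so the quotient errors of the
  conjugated semigroup at \<open>f\<close> and of \<open>T\<close> at the pulled-back
  \<open>f\<close> are the same numbers, and the two limit conditions coincide.\<close>

lemma generator_conjugate_semigroup:
  assumes T: "contraction_semigroup V T"
  shows "generator V (conjugate_semigroup i T) = conjugate_graph i (generator V T)"
proof -
  have "((\<lambda>t. L2_norm V (\<lambda>x. (conjugate_semigroup i T t f x - f x) / t - h x)) \<longlongrightarrow> 0) (at_right 0)
    \<longleftrightarrow> ((\<lambda>t. L2_norm V (\<lambda>x. (T t (\<lambda>y. f (i y)) x - f (i x)) / t - h (i x))) \<longlongrightarrow> 0) (at_right 0)"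
    if "f \<in> L2 V" "h \<in> L2 V" for f h
    using conjugate_semigroup_norm_diff[OF T that]
    by (intro tendsto_cong eventually_mono[OF eventually_at_right_less[of "0::real"]]) auto
  thus ?thesis
    by (auto simp: generator_def conjugate_graph_def L2_automorphism_iff[OF i])
qed

lemma contraction_semigroup_conjugate:
  assumes T: "contraction_semigroup V T"
  shows "contraction_semigroup V (conjugate_semigroup i T)"
  unfolding contraction_semigroup_def
proof (intro conjI allI impI ballI)
  note AEi = AE_automorphism[OF measure_automorphism_inv[OF i]]
  fix t :: real assume t: "0 \<le> t"
  note C = contraction_semigroupD(1)[OF T t]
  show "L2_contraction V (conjugate_semigroup i T t)"
    unfolding L2_contraction_def
  proof (intro conjI ballI allI)
    fix f assume f: "f \<in> L2 V"
    show "conjugate_semigroup i T t f \<in> L2 V"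
      unfolding conjugate_semigroup_def by (intro L2_push contraction_semigroup_mem[OF T t] L2_pull f)
    have "L2_norm V (conjugate_semigroup i T t f) = L2_norm V (T t (\<lambda>y. f (i y)))"
      unfolding conjugate_semigroup_def by (intro norm_push contraction_semigroup_mem[OF T t] L2_pull f)
    also have "\<dots> \<le> L2_norm V (\<lambda>y. f (i y))"
      using C L2_pull[OF f] by (simp add: L2_contraction_def)
    also have "\<dots> = L2_norm V f" by (rule norm_pull[OF f])
    finally show "L2_norm V (conjugate_semigroup i T t f) \<le> L2_norm V f" .
    fix h a b assume h: "h \<in> L2 V"
    show "AE x in V. conjugate_semigroup i T t (\<lambda>y. a * f y + b * h y) x =
           a * conjugate_semigroup i T t f x + b * conjugate_semigroup i T t h x"
      unfolding conjugate_semigroup_def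
      by (rule AEi) (use C L2_pull[OF f] L2_pull[OF h] in \<open>auto simp: L2_contraction_def\<close>)
  qed
next
  note AEi = AE_automorphism[OF measure_automorphism_inv[OF i]]
  fix f assume f: "f \<in> L2 V"
  from AEi[OF contraction_semigroupD(2)[OF T L2_pull[OF f]]]
  show "AE x in V. conjugate_semigroup i T 0 f x = f x"
    by (simp add: conjugate_semigroup_def inverse_simps)
  have "((\<lambda>t. L2_norm V (\<lambda>x. T t (\<lambda>y. f (i y)) x - f (i x))) \<longlongrightarrow> 0) (at_right 0)"
    by (rule contraction_semigroupD(4)[OF T L2_pull[OF f]])
  moreover have "eventually (\<lambda>t. L2_norm V (\<lambda>x. T t (\<lambda>y. f (i y)) x - f (i x))
      = L2_norm V (\<lambda>x. conjugate_semigroup i T t f x - f x)) (at_right 0)"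
    using eventually_at_right_less[of "0::real"]
  proof eventually_elim
    case (elim t)
    have "(\<lambda>x. T t (\<lambda>y. f (i y)) x - f (i x)) \<in> L2 V"
      using elim by (intro L2_diff contraction_semigroup_mem[OF T] L2_pull f) auto
    from norm_push[OF this] show ?case
      by (simp add: conjugate_semigroup_def inverse_simps)
  qed
  ultimately show "((\<lambda>t. L2_norm V (\<lambda>x. conjugate_semigroup i T t f x - f x)) \<longlongrightarrow> 0) (at_right 0)"
    by (rule Lim_transform_eventually)
next
  note AEi = AE_automorphism[OF measure_automorphism_inv[OF i]]
  fix s t :: real and f assume s: "0 \<le> s" "0 \<le> t" and f: "f \<in> L2 V"
  show "AE x in V. conjugate_semigroup i T (s + t) f x
      = conjugate_semigroup i T s (conjugate_semigroup i T t f) x"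
    using AEi[OF contraction_semigroupD(3)[OF T s L2_pull[OF f]]]
    by (simp add: conjugate_semigroup_def inverse_simps)
qed

text \<open>Unitary conjugation commutes with taking adjoints: the pairs to be tested are exactly
  the pairs of \<open>D\<close> moved by \<open>inv i\<close>, and the inner product lets this
  motion be shifted to the other argument.\<close>

lemma L2_self_adjoint_conjugate_graph:
  assumes D: "L2_self_adjoint V D"
  shows "L2_self_adjoint V (conjugate_graph i D)"
proof -
  have adj: "L2_adjoint V D = D" using D by (simp add: L2_self_adjoint_def)
  hence DL2: "f \<in> L2 V \<and> h \<in> L2 V" if "(f, h) \<in> D" for f h
    using that by (auto simp: L2_adjoint_def)
  have push: "((\<lambda>x. f (inv i x)), (\<lambda>x. h (inv i x))) \<in> conjugate_graph i D" if "(f, h) \<in> D" for f h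
    using that by (simp add: conjugate_graph_def inverse_simps)
  have inner: "L2_inner V (\<lambda>x. u (inv i x)) f = L2_inner V u (\<lambda>x. f (i x))"
    if "u \<in> L2 V" "f \<in> L2 V" for u f
    using L2_inner_automorphism[OF i L2_push[OF that(1)] that(2)] by (simp add: inverse_simps)
  have "(f, h) \<in> L2_adjoint V (conjugate_graph i D) \<longleftrightarrow> (f, h) \<in> conjugate_graph i D" for f h
  proof (cases "f \<in> L2 V \<and> h \<in> L2 V")
    case True
    hence L: "f \<in> L2 V" "h \<in> L2 V" "(\<lambda>x. f (i x)) \<in> L2 V" "(\<lambda>x. h (i x)) \<in> L2 V"
      by (auto intro: L2_pull)
    have "(f, h) \<in> L2_adjoint V (conjugate_graph i D)
        \<longleftrightarrow> (\<forall>(u, w)\<in>D. L2_inner V w (\<lambda>x. f (i x)) = L2_inner V u (\<lambda>x. h (i x)))"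
    proof (intro iffI ballI, clarify)
      fix u w assume a: "(f, h) \<in> L2_adjoint V (conjugate_graph i D)" and uw: "(u, w) \<in> D"
      have "L2_inner V (\<lambda>x. w (inv i x)) f = L2_inner V (\<lambda>x. u (inv i x)) h"
        using a push[OF uw] by (auto simp: L2_adjoint_def)
      thus "L2_inner V w (\<lambda>x. f (i x)) = L2_inner V u (\<lambda>x. h (i x))"
        using DL2[OF uw] L by (simp add: inner)
    next
      assume a: "\<forall>(u, w)\<in>D. L2_inner V w (\<lambda>x. f (i x)) = L2_inner V u (\<lambda>x. h (i x))"
      have "L2_inner V w f = L2_inner V u h" if uw: "(u, w) \<in> conjugate_graph i D" for u w
      proof -
        have uw': "((\<lambda>x. u (i x)), (\<lambda>x. w (i x))) \<in> D" using uw by (simp add: conjugate_graph_def)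
        hence "u \<in> L2 V" "w \<in> L2 V" using DL2[OF uw'] by (auto simp: L2_automorphism_iff[OF i])
        thus ?thesis using a uw' L by (auto simp: L2_inner_automorphism[OF i])
      qed
      thus "(f, h) \<in> L2_adjoint V (conjugate_graph i D)" using L by (auto simp: L2_adjoint_def)
    qed
    also have "\<dots> \<longleftrightarrow> ((\<lambda>x. f (i x)), (\<lambda>x. h (i x))) \<in> L2_adjoint V D"
      using L by (simp add: L2_adjoint_def)
    finally show ?thesis by (simp add: adj conjugate_graph_def)
  next
    \<comment> \<open>Outside L2 both memberships fail, since \<open>D\<close> equals its adjoint
      and hence consists of L2 pairs only.\<close>
    case False
    thus ?thesis using DL2[of "\<lambda>x. f (i x)" "\<lambda>x. h (i x)"]
      by (auto simp: L2_adjoint_def conjugate_graph_def L2_automorphism_iff[OF i])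
  qed
  hence "L2_adjoint V (conjugate_graph i D) = conjugate_graph i D" by auto
  moreover have "\<exists>(u, w)\<in>conjugate_graph i D. L2_norm V (\<lambda>x. f x - u x) < e"
    if f: "f \<in> L2 V" and e: "0 < e" for f e
  proof -
    have "\<exists>(u, w)\<in>D. L2_norm V (\<lambda>x. f (i x) - u x) < e"
      using D L2_pull[OF f] e by (simp add: L2_self_adjoint_def)
    then obtain u w where uw: "(u, w) \<in> D" "L2_norm V (\<lambda>x. f (i x) - u x) < e"
      by blast
    have "(\<lambda>x. f (i x) - u x) \<in> L2 V" using DL2[OF uw(1)] by (intro L2_diff L2_pull f) auto
    from norm_push[OF this] uw(2) have "L2_norm V (\<lambda>x. f x - u (inv i x)) < e"
      by (simp add: inverse_simps)
    thus ?thesis by (intro bexI[OF _ push[OF uw(1)]]) simp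
  qed
  moreover have "AE x in V. h x = k x"
    if "(f, h) \<in> conjugate_graph i D" "(f, k) \<in> conjugate_graph i D" for f h k
  proof -
    have "AE x in V. h (i x) = k (i x)"
      using D[unfolded L2_self_adjoint_def, THEN conjunct2, THEN conjunct1, rule_format,
          of "\<lambda>x. f (i x)" "\<lambda>x. h (i x)" "\<lambda>x. k (i x)"] that
      by (simp add: conjugate_graph_def)
    from AE_automorphism[OF measure_automorphism_inv[OF i] this]
    show ?thesis by (simp add: inverse_simps)
  qed
  ultimately show ?thesis unfolding L2_self_adjoint_def by blast
qed

end

section \<open>Isometries in charts\<close>

text \<open>On an open set, agreement near each point gives equal derivatives. Both functions are
  generalised in the induction, because the next step concerns their directional
  derivatives.\<close>

lemma Ck_on_cong:
  assumes "open S" "\<And>x. x \<in> S \<Longrightarrow> f x = h x" "Ck_on k S f"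
  shows "Ck_on k S h"
  using assms(2,3)
proof (induction k arbitrary: f h)
  case 0
  thus ?case using continuous_on_eq[of S f h] by simp
next
  case (Suc k)
  have d: "f differentiable (at x)" if "x \<in> S" for x using Suc.prems(2) that by simp
  have h: "(h has_derivative frechet_derivative f (at x)) (at x)" if "x \<in> S" for x
    by (rule has_derivative_transform_within_open[of f _ x UNIV S, OF _ assms(1) that Suc.prems(1)])
       (use d[OF that] in \<open>simp add: frechet_derivative_works\<close>)
  hence "frechet_derivative h (at x) = frechet_derivative f (at x)" if "x \<in> S" for x
    using that frechet_derivative_at by metis
  moreover have "Ck_on k S (\<lambda>x. frechet_derivative f (at x) v)" for v using Suc.prems(2) by simp
  ultimately have "Ck_on k S (\<lambda>x. frechet_derivative h (at x) v)" for v
    using Suc.IH[of "\<lambda>x. frechet_derivative f (at x) v" "\<lambda>x. frechet_derivative h (at x) v"] by auto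
  thus ?case using h by (auto simp: differentiable_def)
qed

lemma smooth_on_cong:
  "open S \<Longrightarrow> (\<And>x. x \<in> S \<Longrightarrow> f x = h x) \<Longrightarrow> smooth_on S f \<Longrightarrow> smooth_on S h"
  unfolding smooth_on_def using Ck_on_cong[of S f h] by blast

lemma smooth_on_imp_continuous_on: "smooth_on S f \<Longrightarrow> continuous_on S f"
  unfolding smooth_on_def by (metis Ck_on.simps(1))

lemma frechet_derivative_cong_open:
  assumes "open S" "u \<in> S" "\<And>x. x \<in> S \<Longrightarrow> f x = h x"
  shows "frechet_derivative f (at u) = frechet_derivative h (at u)"
proof -
  have "(f has_derivative D) (at u) \<longleftrightarrow> (h has_derivative D) (at u)" for D
    using has_derivative_transform_within_open[of f D u UNIV S h]
      has_derivative_transform_within_open[of h D u UNIV S f] assms by auto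
  thus ?thesis by (simp add: frechet_derivative_def)
qed

lemma partial_cong:
  assumes "open S" "u \<in> S" "\<And>x. x \<in> S \<Longrightarrow> f x = h x"
  shows "partial j f u = partial j h u"
  unfolding partial_def using frechet_derivative_cong_open[OF assms] by simp

section \<open>Charts and their transport by a bijection\<close>

lemma topological_chartD:
  assumes "topological_chart c"
  shows "open (fst c)" "open (snd c ` fst c)" "inj_on (snd c) (fst c)"
    "continuous_on (fst c) (snd c)"
    "continuous_on (snd c ` fst c) (inv_into (fst c) (snd c))"
    "\<And>W. open W \<Longrightarrow> W \<subseteq> fst c \<Longrightarrow> open (snd c ` W)"
proof -
  have h: "homeomorphism (fst c) (snd c ` fst c) (snd c) (inv_into (fst c) (snd c))"
    and o: "open (fst c)" "open (snd c ` fst c)"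
    using assms by (auto simp: topological_chart_def)
  show "open (fst c)" "open (snd c ` fst c)" by (rule o)+
  show "inj_on (snd c) (fst c)"
    using h by (auto simp: homeomorphism_def intro: inj_on_inverseI)
  show "continuous_on (fst c) (snd c)" "continuous_on (snd c ` fst c) (inv_into (fst c) (snd c))"
    using h by (auto simp: homeomorphism_def)
  fix W assume W: "open W" "W \<subseteq> fst c"
  have "openin (top_of_set (snd c ` fst c)) (snd c ` W)"
    using W o by (intro homeomorphism_imp_open_map[OF h]) (auto simp: openin_open_eq)
  thus "open (snd c ` W)" using o by (simp add: openin_open_eq)
qed

lemma chart_topological: "smooth_structure A \<Longrightarrow> c \<in> A \<Longrightarrow> topological_chart c"
  by (simp add: smooth_structure_def)

text \<open>The coordinates of \<open>i x\<close> in the new chart are those of \<open>x\<close> in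
  the old one, so the coordinate domain in Euclidean space is unchanged.\<close>

definition push_chart :: "('a \<Rightarrow> 'a) \<Rightarrow> ('a, 'd) chart \<Rightarrow> ('a, 'd) chart" where
  "push_chart i c = (i ` fst c, \<lambda>x. snd c (inv i x))"

lemma push_chart_image: "bij i \<Longrightarrow> snd (push_chart i c) ` (i ` B) = snd c ` B"
  by (force simp: push_chart_def image_image inv_f_f[OF bij_is_inj])

lemma inv_into_push_chart:
  assumes "bij i" "inj_on (snd c) (fst c)" "u \<in> snd c ` fst c"
  shows "inv_into (fst (push_chart i c)) (snd (push_chart i c)) u = i (inv_into (fst c) (snd c) u)"
proof -
  obtain x where x: "x \<in> fst c" "u = snd c x" using assms(3) by auto
  have "inj_on (snd (push_chart i c)) (fst (push_chart i c))"
    using assms(1,2) by (auto simp: push_chart_def inj_on_def inv_f_f[OF bij_is_inj])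
  moreover have "u = snd (push_chart i c) (i x)" "i x \<in> fst (push_chart i c)"
    using x assms(1) by (auto simp: push_chart_def inv_f_f[OF bij_is_inj])
  ultimately have "inv_into (fst (push_chart i c)) (snd (push_chart i c)) u = i x"
    by (simp add: inv_into_f_f)
  thus ?thesis using x assms(2) by simp
qed

lemma topological_chart_push:
  fixes i :: "'a::topological_space \<Rightarrow> 'a"
  assumes i: "bij i" "continuous_on UNIV i" "continuous_on UNIV (inv i)" and c: "topological_chart c"
  shows "topological_chart (push_chart i c)"
  unfolding topological_chart_def
proof (intro conjI)
  have img: "snd (push_chart i c) ` fst (push_chart i c) = snd c ` fst c"
    using push_chart_image[OF i(1), of c "fst c"] by (simp add: push_chart_def)
  have "i ` fst c = inv i -` fst c" by (rule bij_image_Collect_eq[OF i(1), of "\<lambda>x. x \<in> fst c", simplified, unfolded vimage_def[symmetric]])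
  thus "open (fst (push_chart i c))"
    using continuous_on_open_vimage[OF open_UNIV, of "inv i"] i(3) topological_chartD(1)[OF c]
    by (simp add: push_chart_def)
  show "open (snd (push_chart i c) ` fst (push_chart i c))"
    using topological_chartD(2)[OF c] by (simp add: img)
  have "homeomorphism (i ` fst c) (fst c) (inv i) i"
    using i by (auto simp: homeomorphism_def inv_f_f[OF bij_is_inj] image_image surj_f_inv_f[OF bij_is_surj]
        intro: continuous_on_subset)
  moreover have "homeomorphism (fst c) (snd c ` fst c) (snd c) (inv_into (fst c) (snd c))"
    using c by (simp add: topological_chart_def)
  ultimately have "homeomorphism (i ` fst c) (snd c ` fst c) (snd c \<circ> inv i) (i \<circ> inv_into (fst c) (snd c))"
    by (rule homeomorphism_compose)
  thus "homeomorphism (fst (push_chart i c)) (snd (push_chart i c) ` fst (push_chart i c))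
      (snd (push_chart i c)) (inv_into (fst (push_chart i c)) (snd (push_chart i c)))"
    unfolding img
    by (rule homeomorphism_cong)
       (auto simp: inv_into_push_chart[OF i(1) topological_chartD(3)[OF c]], auto simp: push_chart_def)
qed

text \<open>The atlas is maximal, so a diffeomorphism carries charts to charts.\<close>

lemma push_chart_in_smooth_structure:
  fixes A :: "('a::topological_space, 'd::finite) chart set"
  assumes A: "smooth_structure A" and i: "bij i" "smooth_map A i" "smooth_map A (inv i)" and c: "c \<in> A"
  shows "push_chart i c \<in> A"
proof -
  have cont: "continuous_on UNIV i" "continuous_on UNIV (inv i)"
    using i by (auto simp: smooth_map_def)
  have top: "topological_chart c'" if "c' \<in> A" for c'
    using A that by (simp add: smooth_structure_def)
  have "smoothly_compatible (push_chart i c) c'" if c': "c' \<in> A" for c'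
    unfolding smoothly_compatible_def
  proof
    let ?W = "fst c \<inter> i -` fst c'"
    have set1: "fst (push_chart i c) \<inter> fst c' = i ` ?W" by (auto simp: push_chart_def)
    have "open ?W"
      using topological_chartD(1)[OF top[OF c]] topological_chartD(1)[OF top[OF c']] cont(1)
      by (intro open_Int) (auto simp: continuous_on_open_vimage)
    hence "open (snd c ` ?W)" by (intro topological_chartD(6)[OF top[OF c]]) auto
    \<comment> \<open>The transition from the pushed chart to \<open>c'\<close> is the coordinate
      form of \<open>i\<close>; the opposite transition, treated below, is that of
      \<open>inv i\<close>. Smoothness in both directions is therefore used.\<close>
    moreover have "smooth_on (snd c ` ?W) (local_rep c c' i)"
      using i(2) c c' by (simp add: smooth_map_def)
    moreover have "local_rep c c' i u = transition (push_chart i c) c' u" if "u \<in> snd c ` ?W" for u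
      using inv_into_push_chart[OF i(1) topological_chartD(3)[OF top[OF c]], of u] that
      by (auto simp: local_rep_def transition_def)
    ultimately have "smooth_on (snd c ` ?W) (transition (push_chart i c) c')"
      using smooth_on_cong by blast
    thus "smooth_on (snd (push_chart i c) ` (fst (push_chart i c) \<inter> fst c')) (transition (push_chart i c) c')"
      by (simp only: set1 push_chart_image[OF i(1)])
    have "fst (push_chart i c) \<inter> fst c' = fst c' \<inter> inv i -` fst c"
      using i(1) by (force simp: push_chart_def inv_f_f[OF bij_is_inj] surj_f_inv_f[OF bij_is_surj] image_iff)
    moreover have "transition c' (push_chart i c) = local_rep c' c (inv i)"
      by (simp add: transition_def local_rep_def push_chart_def)
    ultimately show "smooth_on (snd c' ` (fst (push_chart i c) \<inter> fst c')) (transition c' (push_chart i c))"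
      using i(3) c c' by (simp add: smooth_map_def)
  qed
  thus ?thesis
    using A topological_chart_push[OF i(1) cont top[OF c]] unfolding smooth_structure_def by blast
qed

context
  fixes A :: "('a::topological_space, 'd::finite) chart set"
    and g :: "('a, 'd) chart \<Rightarrow> 'a \<Rightarrow> real ^ 'd ^ 'd" and i
  assumes A: "smooth_structure A" and i: "i \<in> isometries A g"
begin

lemma isometry_bij: "bij i"
  and isometry_smooth: "smooth_map A i" "smooth_map A (inv i)"
  and isometry_continuous: "continuous_on UNIV i" "continuous_on UNIV (inv i)"
  using i by (auto simp: isometries_def smooth_map_def)

lemma push_chart_isometry: "c \<in> A \<Longrightarrow> push_chart i c \<in> A"
  by (rule push_chart_in_smooth_structure[OF A isometry_bij isometry_smooth])

lemma inv_into_push_chart_isometry: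
  "c \<in> A \<Longrightarrow> u \<in> snd c ` fst c \<Longrightarrow>
    inv_into (fst (push_chart i c)) (snd (push_chart i c)) u = i (inv_into (fst c) (snd c) u)"
  by (rule inv_into_push_chart[OF isometry_bij topological_chartD(3)[OF chart_topological[OF A]]])

text \<open>In the charts \<open>c\<close> and \<open>push_chart i c\<close> the isometry is the identity of coordinates, so all
  coordinate expressions at \<open>x\<close> and at \<open>i x\<close> coincide.\<close>

lemma metric_push_chart:
  assumes c: "c \<in> A" and x: "x \<in> fst c"
  shows "g (push_chart i c) (i x) = g c x"
proof -
  let ?L = "local_rep c (push_chart i c) i"
  note top = chart_topological[OF A c]
  have "?L u = u" if "u \<in> snd c ` fst c" for u
    using that isometry_bij by (simp add: local_rep_def push_chart_def inv_f_f[OF bij_is_inj] f_inv_into_f)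
  hence "frechet_derivative ?L (at (snd c x)) = frechet_derivative (\<lambda>u. u) (at (snd c x))"
    using x by (intro frechet_derivative_cong_open[OF topological_chartD(2)[OF top]]) auto
  hence "jacobian ?L (at (snd c x)) = mat 1"
    using matrix_id_mat_1 by (simp add: jacobian_def id_def)
  moreover have "i x \<in> fst (push_chart i c)" using x by (simp add: push_chart_def)
  ultimately show ?thesis
    using i push_chart_isometry[OF c] c x unfolding isometries_def Let_def
    by (fastforce simp: transpose_mat)
qed

text \<open>The two coordinate integrands agree only on the chart image; its openness lets both
  nested partial derivatives be replaced.\<close>

lemma laplacian_in_chart_push:
  assumes c: "c \<in> A" and x: "x \<in> fst c"
  shows "laplacian_in_chart g c (\<lambda>y. f (i y)) x = laplacian_in_chart g (push_chart i c) f (i x)"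
proof -
  note top = topological_chartD(2)[OF chart_topological[OF A c]]
  note q = inv_into_push_chart_isometry[OF c]
  have gq: "g (push_chart i c) (i (inv_into (fst c) (snd c) u)) = g c (inv_into (fst c) (snd c) u)"
    if "u \<in> snd c ` fst c" for u
    using that by (intro metric_push_chart c) (auto intro: inv_into_into)
  have pt: "snd (push_chart i c) (i x) = snd c x"
    using isometry_bij by (simp add: push_chart_def inv_f_f[OF bij_is_inj])
  have inner: "partial j (\<lambda>w. f (i (inv_into (fst c) (snd c) w))) u
      = partial j (\<lambda>w. f (inv_into (fst (push_chart i c)) (snd (push_chart i c)) w)) u"
    if "u \<in> snd c ` fst c" for u j
    by (rule partial_cong[OF top that]) (simp add: q)
  show ?thesis
    unfolding laplacian_in_chart_def Let_def pt metric_push_chart[OF c x]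
    by (intro arg_cong2[where f = "(/)"] sum.cong partial_cong[OF top] refl)
       (use x in \<open>auto simp: q gq inner\<close>)
qed

lemma laplacian_Cc_isometry:
  assumes "(f, h) \<in> laplacian_Cc A g"
  shows "((\<lambda>x. f (i x)), (\<lambda>x. h (i x))) \<in> laplacian_Cc A g"
proof -
  have f: "smooth_fun A f" and comp: "compact (closure {x. f x \<noteq> 0})"
    and h: "\<And>c x. c \<in> A \<Longrightarrow> x \<in> fst c \<Longrightarrow> h x = laplacian_in_chart g c f x"
    using assms by (auto simp: laplacian_Cc_def)
  have "smooth_fun A (\<lambda>x. f (i x))"
    unfolding smooth_fun_def
  proof
    fix c assume c: "c \<in> A"
    have "snd (push_chart i c) ` fst (push_chart i c) = snd c ` fst c"
      using push_chart_image[OF isometry_bij, of c "fst c"] by (simp add: push_chart_def)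
    hence "smooth_on (snd c ` fst c) (\<lambda>u. f (inv_into (fst (push_chart i c)) (snd (push_chart i c)) u))"
      using f push_chart_isometry[OF c] unfolding smooth_fun_def by metis
    thus "smooth_on (snd c ` fst c) (\<lambda>u. f (i (inv_into (fst c) (snd c) u)))"
      by (rule smooth_on_cong[OF topological_chartD(2)[OF chart_topological[OF A c]], rotated])
         (simp add: inv_into_push_chart_isometry[OF c])
  qed
  moreover have "compact (closure {x. f (i x) \<noteq> 0})"
  proof -
    \<comment> \<open>The preimage of \<open>?C\<close> has two roles: as a preimage under
      \<open>i\<close> it is closed and so contains the new support, as an image under
      \<open>inv i\<close> it is compact.\<close>
    let ?C = "closure {x. f x \<noteq> 0}"
    have eq: "inv i ` ?C = i -` ?C"
      using isometry_bij by (simp add: bij_vimage_eq_inv_image)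
    have "closed (i -` ?C)"
      using isometry_continuous(1) by (intro closed_vimage) auto
    moreover have "{x. f (i x) \<noteq> 0} \<subseteq> i -` ?C"
      using closure_subset[of "{x. f x \<noteq> 0}"] by auto
    ultimately have "closure {x. f (i x) \<noteq> 0} \<subseteq> i -` ?C" by (intro closure_minimal)
    moreover have "compact (i -` ?C)"
      unfolding eq[symmetric] using isometry_continuous(2)
      by (intro compact_continuous_image comp) (auto intro: continuous_on_subset)
    ultimately show ?thesis
      using compact_Int_closed[of "i -` ?C" "closure {x. f (i x) \<noteq> 0}"] by (simp add: Int_absorb1)
  qed
  moreover have "h (i x) = laplacian_in_chart g c (\<lambda>y. f (i y)) x" if "c \<in> A" "x \<in> fst c" for c x
    using that h[of "push_chart i c" "i x"] push_chart_isometry[of c]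
    by (simp add: laplacian_in_chart_push) (simp add: push_chart_def)
  ultimately show ?thesis by (simp add: laplacian_Cc_def)
qed

end

section \<open>Invariance of the heat kernel\<close>

lemma sets_riemannian_measure: "riemannian_measure A g V \<Longrightarrow> sets V = sets borel"
  unfolding riemannian_measure_def by (rule conjunct1)

lemma emeasure_riemannian_measure:
  "riemannian_measure A g V \<Longrightarrow> c \<in> A \<Longrightarrow> B \<in> sets borel \<Longrightarrow> B \<subseteq> fst c \<Longrightarrow>
    emeasure V B = (\<integral>\<^sup>+ u. ennreal (sqrt (det (g c (inv_into (fst c) (snd c) u)))) *
      indicator (snd c ` B) u \<partial>lborel)"
  unfolding riemannian_measure_def by blast

text \<open>Computed in \<open>c\<close> and in \<open>push_chart i c\<close>, the two measures are
  the same Euclidean integral: same coordinate set and, by \<open>metric_push_chart\<close>, same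
  density.\<close>

lemma emeasure_push_chart:
  assumes A: "smooth_structure A" and i: "i \<in> isometries A g" and V: "riemannian_measure A g V"
    and c: "c \<in> A" and B: "B \<in> sets borel" "B \<subseteq> fst c"
  shows "emeasure V (i ` B) = emeasure V B"
proof -
  have bij: "bij i" by (rule isometry_bij[OF A i])
  have "i ` B = inv i -` B" by (simp add: bij bij_vimage_eq_inv_image bij_imp_bij_inv inv_inv_eq)
  moreover have "inv i -` B \<in> sets borel"
    using borel_measurable_continuous_onI[OF isometry_continuous(2)[OF A i]] B(1)
    by (rule measurable_sets_borel)
  ultimately have iB: "i ` B \<in> sets borel" by (simp only:)
  have sub: "i ` B \<subseteq> fst (push_chart i c)"
    unfolding push_chart_def fst_conv using B(2) by (rule image_mono)
  have "emeasure V (i ` B) = (\<integral>\<^sup>+ u. ennreal (sqrt (det (g (push_chart i c)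
      (inv_into (fst (push_chart i c)) (snd (push_chart i c)) u)))) * indicator (snd c ` B) u \<partial>lborel)"
    unfolding emeasure_riemannian_measure[OF V push_chart_isometry[OF A i c] iB sub]
      push_chart_image[OF bij] ..
  also have "\<dots> = (\<integral>\<^sup>+ u. ennreal (sqrt (det (g c (inv_into (fst c) (snd c) u)))) *
      indicator (snd c ` B) u \<partial>lborel)"
  proof (intro nn_integral_cong)
    fix u show "ennreal (sqrt (det (g (push_chart i c)
        (inv_into (fst (push_chart i c)) (snd (push_chart i c)) u)))) * indicator (snd c ` B) u
      = ennreal (sqrt (det (g c (inv_into (fst c) (snd c) u)))) * indicator (snd c ` B) u"
    proof (cases "u \<in> snd c ` B")
      case True
      hence u: "u \<in> snd c ` fst c" using B(2) by auto
      show ?thesis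
        using inv_into_push_chart_isometry[OF A i c u] metric_push_chart[OF A i c inv_into_into[OF u]]
        by simp
    qed simp
  qed
  also have "\<dots> = emeasure V B"
    by (rule emeasure_riemannian_measure[OF V c B, symmetric])
  finally show ?thesis .
qed

text \<open>By the Lindelof property countably many chart domains suffice, which makes countable
  additivity of the measure applicable.\<close>

lemma countable_chart_cover:
  fixes A :: "('a::second_countable_topology, 'd::finite) chart set"
  assumes A: "smooth_structure A"
  shows "\<exists>C :: nat \<Rightarrow> ('a, 'd) chart. (\<forall>n. C n \<in> A) \<and> (\<Union>n. fst (C n)) = UNIV"
proof -
  have "openin (top_of_set UNIV) S" if "S \<in> fst ` A" for S
    using that A topological_chartD(1) by (auto simp: smooth_structure_def)
  then obtain F where F: "F \<subseteq> fst ` A" "countable F" "\<Union>F = \<Union>(fst ` A)"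
    by (rule Lindelof_openin)
  have U: "\<Union>F = UNIV" using F(3) A by (simp add: smooth_structure_def)
  hence ne: "F \<noteq> {}" by auto
  have "\<exists>c\<in>A. fst c = from_nat_into F n" for n
    using from_nat_into[OF ne, of n] F(1) by fastforce
  then obtain C where C: "\<And>n. C n \<in> A" "\<And>n. fst (C n) = from_nat_into F n" by metis
  have "(\<Union>n. fst (C n)) = UNIV"
    using U range_from_nat_into[OF ne F(2)] by (simp add: C(2))
  with C(1) show ?thesis by auto
qed

lemma measure_automorphism_isometry:
  fixes A :: "('a::second_countable_topology, 'd::finite) chart set"
  assumes A: "smooth_structure A" and i: "i \<in> isometries A g" and V: "riemannian_measure A g V"
  shows "measure_automorphism V i"
proof -
  have sV: "sets V = sets borel" by (rule sets_riemannian_measure[OF V])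
  have bij: "bij i" by (rule isometry_bij[OF A i])
  have mb: "i \<in> borel_measurable borel" "inv i \<in> borel_measurable borel"
    by (rule borel_measurable_continuous_onI, rule isometry_continuous[OF A i])+
  have m: "i \<in> measurable V V" "inv i \<in> measurable V V"
    using mb by (simp_all only: measurable_cong_sets[OF sV sV])
  have spV: "space V = UNIV" using sets_eq_imp_space_eq[OF sV] by simp
  obtain C :: "nat \<Rightarrow> ('a, 'd) chart" where C: "\<And>n. C n \<in> A" "(\<Union>n. fst (C n)) = UNIV"
    using countable_chart_cover[OF A] by metis
  have "emeasure (distr V V i) B = emeasure V B" if B: "B \<in> sets borel" for B
  proof -
    \<comment> \<open>Each piece of the preimage lies in a single chart, and the images of the
      pieces are disjoint with union \<open>B\<close>.\<close>
    let ?P = "\<lambda>n. i -` B \<inter> disjointed (\<lambda>n. fst (C n)) n"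
    have iB: "i -` B \<in> sets borel" by (rule measurable_sets_borel[OF mb(1) B])
    have "open (fst (C n))" for n
      by (rule topological_chartD(1)[OF chart_topological[OF A C(1)]])
    hence "range (\<lambda>n. fst (C n)) \<subseteq> sets borel" by auto
    hence "range (disjointed (\<lambda>n. fst (C n))) \<subseteq> sets borel" by (rule sets.range_disjointed_sets)
    hence P: "?P n \<in> sets borel" for n by (intro sets.Int iB) blast
    have iP: "i ` ?P n \<in> sets borel" for n
    proof -
      have "i ` ?P n = inv i -` ?P n"
        using bij_vimage_eq_inv_image[OF bij_imp_bij_inv[OF bij], of "?P n"] inv_inv_eq[OF bij]
        by (simp only:)
      thus ?thesis using measurable_sets_borel[OF mb(2) P[of n]] by (simp only:)
    qed
    have disj: "disjoint_family ?P"
      using disjoint_family_disjointed[of "\<lambda>n. fst (C n)"] by (auto simp: disjoint_family_on_def)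
    have UP: "(\<Union>n. ?P n) = i -` B" using C(2) UN_disjointed_eq[of "\<lambda>n. fst (C n)"] by auto
    have "emeasure (distr V V i) B = emeasure V (\<Union>n. ?P n)"
      unfolding UP using B by (subst emeasure_distr[OF m(1)]) (simp_all add: sV spV)
    also have "\<dots> = (\<Sum>n. emeasure V (?P n))"
      using P disj by (intro suminf_emeasure[symmetric]) (auto simp: sV)
    also have "\<dots> = (\<Sum>n. emeasure V (i ` ?P n))"
      using disjointed_subset[of "\<lambda>n. fst (C n)"]
      by (intro suminf_cong emeasure_push_chart[symmetric, OF A i V C(1) P]) auto
    also have "\<dots> = emeasure V (\<Union>n. i ` ?P n)"
    proof (intro suminf_emeasure)
      show "disjoint_family (\<lambda>n. i ` ?P n)"
        using disj bij_is_inj[OF bij] by (simp add: disjoint_family_on_def image_Int[symmetric])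
    qed (use iP in \<open>auto simp: sV\<close>)
    also have "(\<Union>n. i ` ?P n) = i ` (i -` B)" using UP by (metis image_UN)
    also have "\<dots> = B" using bij by (simp add: bij_is_surj surj_image_vimage_eq)
    finally show ?thesis .
  qed
  hence "distr V V i = V" by (intro measure_eqI) (simp_all add: sV)
  thus ?thesis using bij m by (simp add: measure_automorphism_def)
qed

section \<open>Positivity and local finiteness of the Riemannian measure\<close>

lemma continuous_on_det:
  fixes G :: "'b::topological_space \<Rightarrow> real ^ 'd::finite ^ 'd"
  assumes "continuous_on S G"
  shows "continuous_on S (\<lambda>u. det (G u))"
  unfolding det_def by (intro continuous_intros assms)

text \<open>The determinant does not vanish on the segment from the matrix to the identity.\<close>

lemma det_positive_definite:
  fixes G :: "real ^ 'd::finite ^ 'd"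
  assumes G: "\<And>v. v \<noteq> 0 \<Longrightarrow> 0 < v \<bullet> (G *v v)"
  shows "0 < det G"
proof (rule ccontr)
  assume "\<not> 0 < det G"
  let ?M = "\<lambda>s :: real. s *\<^sub>R mat 1 + (1 - s) *\<^sub>R G"
  have "continuous_on {0..1} (\<lambda>s. det (?M s))"
    by (intro continuous_on_det continuous_intros)
  with \<open>\<not> 0 < det G\<close> obtain s where s: "0 \<le> s" "s \<le> 1" "det (?M s) = 0"
    using IVT'[of "\<lambda>s. det (?M s)" 0 0 1] by auto
  then obtain v where v: "v \<noteq> 0" "?M s *v v = 0"
    using matrix_left_invertible_ker[of "?M s"]
    by (auto simp: invertible_left_inverse[symmetric] invertible_det_nz)
  have "0 = v \<bullet> (?M s *v v)" using v by simp
  also have "\<dots> = s * (v \<bullet> v) + (1 - s) * (v \<bullet> (G *v v))"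
    by (simp add: matrix_vector_mult_add_rdistrib inner_add_right scaleR_matrix_vector_assoc[symmetric])
  also have "\<dots> > 0"
  proof (cases "s = 0")
    case True thus ?thesis using G[OF v(1)] by simp
  next
    case False
    thus ?thesis using s(1,2) G[OF v(1)] v(1) by (intro add_pos_nonneg) auto
  qed
  finally show False by simp
qed

context
  fixes A :: "('a::topological_space, 'd::finite) chart set"
    and g :: "('a, 'd) chart \<Rightarrow> 'a \<Rightarrow> real ^ 'd ^ 'd" and V c
  assumes A: "smooth_structure A" and g: "riemannian_metric A g" and V: "riemannian_measure A g V"
    and c: "c \<in> A"
begin

abbreviation volume_density :: "real ^ 'd \<Rightarrow> real" where
  "volume_density \<equiv> \<lambda>u. sqrt (det (g c (inv_into (fst c) (snd c) u)))"

lemma continuous_on_volume_density: "continuous_on (snd c ` fst c) volume_density"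
proof -
  have "smooth_on (snd c ` fst c) (\<lambda>u. g c (inv_into (fst c) (snd c) u))"
    using g c by (simp add: riemannian_metric_def)
  thus ?thesis by (intro continuous_intros continuous_on_det smooth_on_imp_continuous_on)
qed

lemma volume_density_pos:
  assumes "u \<in> snd c ` fst c"
  shows "0 < volume_density u"
  using g c inv_into_into[OF assms]
  by (auto simp: riemannian_metric_def intro!: det_positive_definite)

text \<open>The coordinate image is a nonempty open set, which is not Lebesgue negligible, and the
  density is strictly positive on it.\<close>

lemma emeasure_open_in_chart_pos:
  assumes W: "open W" "W \<subseteq> fst c" "W \<noteq> {}"
  shows "0 < emeasure V W"
proof -
  note top = topological_chartD[OF chart_topological[OF A c]]
  have oW: "open (snd c ` W)" using top(6) W by blast
  have eq: "emeasure V W = (\<integral>\<^sup>+ u. ennreal (volume_density u) * indicator (snd c ` W) u \<partial>lborel)"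
    using W by (intro emeasure_riemannian_measure[OF V c]) auto
  have meas: "(\<lambda>u. ennreal (volume_density u) * indicator (snd c ` W) u) \<in> borel_measurable lborel"
  proof -
    have "(\<lambda>u. indicator (snd c ` W) u *\<^sub>R volume_density u) \<in> borel_measurable borel"
      using oW W(2) by (intro borel_measurable_continuous_on_indicator
          continuous_on_subset[OF continuous_on_volume_density]) auto
    hence "(\<lambda>u. ennreal (indicator (snd c ` W) u *\<^sub>R volume_density u)) \<in> borel_measurable lborel" by simp
    also have "(\<lambda>u. ennreal (indicator (snd c ` W) u *\<^sub>R volume_density u))
        = (\<lambda>u. ennreal (volume_density u) * indicator (snd c ` W) u)"
      by (auto simp: fun_eq_iff split: split_indicator)
    finally show ?thesis .
  qed
  show ?thesis
  proof (rule ccontr)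
    assume "\<not> ?thesis"
    hence "AE u in lborel. ennreal (volume_density u) * indicator (snd c ` W) u = 0"
      using nn_integral_0_iff_AE[OF meas] eq by simp
    hence "AE u in lborel. u \<notin> snd c ` W"
    proof eventually_elim
      case (elim u)
      show ?case
      proof
        assume u: "u \<in> snd c ` W"
        hence "0 < volume_density u" using W(2) by (intro volume_density_pos) auto
        thus False using elim u by (simp add: ennreal_eq_0_iff)
      qed
    qed
    hence "emeasure lborel (snd c ` W) = 0"
      using oW by (subst (asm) AE_iff_measurable[of "snd c ` W"]) auto
    hence "snd c ` W \<in> null_sets lebesgue"
      using oW by (intro null_sets_completionI) (simp add: null_sets_def)
    hence "snd c ` W = {}" using open_not_negligible[OF oW] by (auto simp: negligible_iff_null_sets)
    thus False using W(3) by simp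
  qed
qed

text \<open>Over a closed coordinate ball the continuous density is bounded, so the preimage of the
  open ball has finite measure. This places indicators of small neighbourhoods in L2.\<close>

lemma finite_emeasure_neighbourhood:
  assumes U: "open U" "x \<in> U" "U \<subseteq> fst c"
  obtains W where "open W" "x \<in> W" "W \<subseteq> U" "emeasure V W < \<infinity>"
proof -
  note top = topological_chartD[OF chart_topological[OF A c]]
  have "open (snd c ` U)" using top(6) U by blast
  then obtain r where r: "0 < r" "cball (snd c x) r \<subseteq> snd c ` U"
    using open_contains_cball U(2) by (metis imageI)
  have sub: "cball (snd c x) r \<subseteq> snd c ` fst c" using r(2) U(3) by blast
  define W where "W = fst c \<inter> snd c -` ball (snd c x) r"
  have "open W" unfolding W_def by (rule continuous_open_preimage[OF top(4,1)]) simp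
  have "x \<in> W" using U r by (auto simp: W_def)
  have "W \<subseteq> U"
  proof
    fix y assume y: "y \<in> W"
    hence "snd c y \<in> snd c ` U" using r(2) by (auto simp: W_def)
    thus "y \<in> U" using y top(3) U(3) by (auto simp: W_def dest: inj_onD)
  qed
  have "compact (volume_density ` cball (snd c x) r)"
    by (intro compact_continuous_image continuous_on_subset[OF continuous_on_volume_density sub]) simp
  then obtain M where M: "\<And>u. u \<in> cball (snd c x) r \<Longrightarrow> volume_density u \<le> M"
    by (meson bdd_above.unfold bounded_imp_bdd_above compact_imp_bounded imageI)
  have img: "snd c ` W \<subseteq> ball (snd c x) r" by (auto simp: W_def)
  have "emeasure V W = (\<integral>\<^sup>+ u. ennreal (volume_density u) * indicator (snd c ` W) u \<partial>lborel)"
    using \<open>open W\<close> by (intro emeasure_riemannian_measure[OF V c]) (auto simp: W_def)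
  also have "\<dots> \<le> (\<integral>\<^sup>+ u. ennreal M * indicator (ball (snd c x) r) u \<partial>lborel)"
    using M img by (intro nn_integral_mono) (auto split: split_indicator intro!: ennreal_leI)
  also have "\<dots> = ennreal M * emeasure lborel (ball (snd c x) r)"
    by (simp add: nn_integral_cmult_indicator)
  also have "\<dots> < \<infinity>"
    using emeasure_lborel_ball_finite[of "snd c x" r] by (simp add: ennreal_mult_less_top)
  finally show ?thesis using that \<open>open W\<close> \<open>x \<in> W\<close> \<open>W \<subseteq> U\<close> by blast
qed

end

text \<open>A kernel which is positive near a point \<open>(x, y)\<close> integrates to something positive against
  the indicator of a small neighbourhood of \<open>y\<close>.\<close>

lemma continuous_kernel_nonpos:
  fixes A :: "('a::topological_space, 'd::finite) chart set"
  assumes A: "smooth_structure A" and g: "riemannian_metric A g" and V: "riemannian_measure A g V"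
    and K: "continuous_on UNIV (\<lambda>(x, y). K x y :: real)"
    and zero: "\<And>f. f \<in> L2 V \<Longrightarrow>
      AE x in V. integrable V (\<lambda>y. K x y * f y) \<and> (\<integral>y. K x y * f y \<partial>V) = 0"
  shows "K x y \<le> 0"
proof (rule ccontr)
  assume "\<not> K x y \<le> 0"
  define e where "e = K x y / 2"
  have e: "0 < e" using \<open>\<not> K x y \<le> 0\<close> by (simp add: e_def)
  have sV: "sets V = sets borel" by (rule sets_riemannian_measure[OF V])
  have "open ((\<lambda>(x, y). K x y) -` {e<..})"
    by (rule open_vimage[OF open_greaterThan K])
  moreover have "(x, y) \<in> (\<lambda>(x, y). K x y) -` {e<..}"
    using \<open>\<not> K x y \<le> 0\<close> by (simp add: e_def)
  ultimately obtain U1 U2 where U: "open U1" "open U2" "(x, y) \<in> U1 \<times> U2"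
      "U1 \<times> U2 \<subseteq> (\<lambda>(x, y). K x y) -` {e<..}"
    by (rule open_prod_elim)
  obtain c c' where c: "c \<in> A" "x \<in> fst c" "c' \<in> A" "y \<in> fst c'"
    using A unfolding smooth_structure_def by blast
  note o = topological_chartD(1)[OF chart_topological[OF A]]
  obtain W where W: "open W" "y \<in> W" "W \<subseteq> U2 \<inter> fst c'" "emeasure V W < \<infinity>"
    using finite_emeasure_neighbourhood[OF A g V c(3), of "U2 \<inter> fst c'" y] U o[OF c(3)] c by auto
  have Wpos: "0 < measure V W"
    using emeasure_open_in_chart_pos[OF A g V c(3) W(1)] W by (auto simp: measure_def enn2real_positive_iff)
  have Ws: "W \<in> sets V" using W(1) by (simp add: sV)
  have "indicator W \<in> L2 V"
    using W(4) Ws by (auto simp: L2_def power2_eq_square indicator_inter_arith[symmetric])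
  from zero[OF this]
  \<comment> \<open>At a point of this set the vanishing integral would be at least
    \<open>e * measure V W\<close>. The intersection with \<open>fst c\<close> is taken because open
    sets are known to have positive measure inside a chart.\<close>
  have "AE x in V. x \<notin> U1 \<inter> fst c"
  proof eventually_elim
    case (elim x')
    show ?case
    proof
      assume x': "x' \<in> U1 \<inter> fst c"
      have Ke: "e < K x' z" if "z \<in> W" for z
        using subsetD[OF U(4), of "(x', z)"] subsetD[OF W(3) that] x' by simp
      have "e * measure V W = (\<integral>y. e * indicator W y \<partial>V)" using W(4) Ws by simp
      also have "\<dots> \<le> (\<integral>y. K x' y * indicator W y \<partial>V)"
        using elim W(4) Ws
        by (intro integral_mono) (auto split: split_indicator intro!: less_imp_le Ke)
      finally have "e * measure V W \<le> 0" using elim by simp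
      thus False using e Wpos by (simp add: mult_le_0_iff)
    qed
  qed
  hence "emeasure V (U1 \<inter> fst c) = 0"
    using U(1) o[OF c(1)] sets_eq_imp_space_eq[OF sV]
    by (subst (asm) AE_iff_measurable[of "U1 \<inter> fst c"]) (auto simp: sV)
  moreover have "0 < emeasure V (U1 \<inter> fst c)"
    using U c o[OF c(1)] by (intro emeasure_open_in_chart_pos[OF A g V c(1)]) auto
  ultimately show False by simp
qed

text \<open>The one-sided bound is applied to both differences of the kernels; integrability of both
  products is part of \<open>KL\<close> because the integrals are subtracted.\<close>

lemma continuous_kernel_eq:
  fixes A :: "('a::topological_space, 'd::finite) chart set"
  assumes A: "smooth_structure A" and g: "riemannian_metric A g" and V: "riemannian_measure A g V"
    and K: "continuous_on UNIV (\<lambda>(x, y). K x y :: real)" and L: "continuous_on UNIV (\<lambda>(x, y). L x y :: real)"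
    and KL: "\<And>f. f \<in> L2 V \<Longrightarrow> AE x in V. integrable V (\<lambda>y. K x y * f y) \<and>
      integrable V (\<lambda>y. L x y * f y) \<and> (\<integral>y. K x y * f y \<partial>V) = (\<integral>y. L x y * f y \<partial>V)"
  shows "K x y = L x y"
proof (rule antisym)
  have "K x y - L x y \<le> 0"
  proof (rule continuous_kernel_nonpos[OF A g V, of "\<lambda>x y. K x y - L x y"])
    show "continuous_on UNIV (\<lambda>(x, y). K x y - L x y)"
      using continuous_on_diff[OF K L] by (simp add: case_prod_unfold)
    show "AE x in V. integrable V (\<lambda>y. (K x y - L x y) * f y) \<and> (\<integral>y. (K x y - L x y) * f y \<partial>V) = 0"
      if "f \<in> L2 V" for f
      using KL[OF that] by eventually_elim (auto simp: left_diff_distrib)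
  qed
  thus "K x y \<le> L x y" by simp
  have "L x y - K x y \<le> 0"
  proof (rule continuous_kernel_nonpos[OF A g V, of "\<lambda>x y. L x y - K x y"])
    show "continuous_on UNIV (\<lambda>(x, y). L x y - K x y)"
      using continuous_on_diff[OF L K] by (simp add: case_prod_unfold)
    show "AE x in V. integrable V (\<lambda>y. (L x y - K x y) * f y) \<and> (\<integral>y. (L x y - K x y) * f y \<partial>V) = 0"
      if "f \<in> L2 V" for f
      using KL[OF that] by eventually_elim (auto simp: left_diff_distrib)
  qed
  thus "L x y \<le> K x y" by simp
qed

section \<open>From the heat semigroup to its kernel\<close>

lemma heat_semigroup_isometry:
  fixes A :: "('a::second_countable_topology, 'd::finite) chart set"
  assumes A: "smooth_structure A" and i: "i \<in> isometries A g" and V: "riemannian_measure A g V"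
    and T: "is_heat_semigroup A g V T" and t: "0 \<le> t" and f: "f \<in> L2 V"
  shows "AE x in V. conjugate_semigroup i T t f x = T t f x"
proof -
  note aut = measure_automorphism_isometry[OF A i V]
  have sg: "contraction_semigroup V T" and sa: "L2_self_adjoint V (generator V T)"
    and sub: "laplacian_Cc A g \<subseteq> generator V T"
    and uniq: "\<And>D. L2_self_adjoint V D \<Longrightarrow> laplacian_Cc A g \<subseteq> D \<Longrightarrow> D = generator V T"
    using T by (auto simp: is_heat_semigroup_def is_laplacian_def)
  have "laplacian_Cc A g \<subseteq> conjugate_graph i (generator V T)"
    using laplacian_Cc_isometry[OF A i] sub by (auto simp: conjugate_graph_def)
  hence "conjugate_graph i (generator V T) = generator V T"
    by (intro uniq L2_self_adjoint_conjugate_graph[OF aut sa])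
  hence gen: "generator V (conjugate_semigroup i T) = generator V T"
    using generator_conjugate_semigroup[OF aut sg] by simp
  show ?thesis
  proof (rule contraction_semigroup_eq_of_generator_eq[OF contraction_semigroup_conjugate[OF aut sg] sg gen _ t f])
    show "\<exists>(u, w)\<in>generator V (conjugate_semigroup i T). L2_norm V (\<lambda>x. f x - u x) < e"
      if "f \<in> L2 V" "0 < e" for f e
      using sa that by (simp add: gen L2_self_adjoint_def)
  qed
qed

text \<open>Continuity is local, and products of chart domains form an open cover. On each of them
  the kernel at fixed \<open>t\<close> is its jointly smooth coordinate form composed with the two
  charts.\<close>

lemma continuous_on_heat_kernel:
  fixes A :: "('a::topological_space, 'd::finite) chart set"
  assumes A: "smooth_structure A" and H: "is_heat_kernel A g V H" and t: "0 < t"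
  shows "continuous_on UNIV (\<lambda>(x, y). H t x y)"
proof -
  let ?B = "\<lambda>(c, c'). fst c \<times> fst c'"
  note top = topological_chartD[OF chart_topological[OF A]]
  have cont: "continuous_on (\<Union>p\<in>A \<times> A. ?B p) (\<lambda>(x, y). H t x y)"
  proof (rule continuous_on_open_UN)
    fix p assume "p \<in> A \<times> A"
    then obtain c c' where p: "p = (c, c')" "c \<in> A" "c' \<in> A" by auto
    show "open (?B p)" using open_Times[OF top(1)[OF p(2)] top(1)[OF p(3)]] by (simp add: p(1))
    let ?q = "inv_into (fst c) (snd c)" and ?q' = "inv_into (fst c') (snd c')"
    have "continuous_on ({0<..} \<times> (snd c ` fst c) \<times> (snd c' ` fst c'))
        (\<lambda>(t :: real, u, w). H t (?q u) (?q' w))"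
      using H p by (intro smooth_on_imp_continuous_on) (simp add: is_heat_kernel_def)
    moreover have "continuous_on (fst c \<times> fst c') (\<lambda>z. (t, snd c (fst z), snd c' (snd z)))"
      using p by (intro continuous_intros continuous_on_compose2[OF top(4)]) auto
    ultimately have "continuous_on (fst c \<times> fst c')
        (\<lambda>z. (\<lambda>(t :: real, u, w). H t (?q u) (?q' w)) (t, snd c (fst z), snd c' (snd z)))"
      by (rule continuous_on_compose2) (use t in auto)
    thus "continuous_on (?B p) (\<lambda>(x, y). H t x y)"
      unfolding p(1) prod.case
      by (rule continuous_on_eq) (use top(3) p in auto)
  qed
  have "z \<in> (\<Union>p\<in>A \<times> A. ?B p)" for z
  proof -
    have cover: "\<exists>c\<in>A. x \<in> fst c" for x
      using A unfolding smooth_structure_def by blast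
    obtain c c' where "c \<in> A" "fst z \<in> fst c" "c' \<in> A" "snd z \<in> fst c'"
      using cover[of "fst z"] cover[of "snd z"] by blast
    thus ?thesis by (intro UN_I[of "(c, c')"]) (auto simp: mem_Times_iff)
  qed
  hence "(\<Union>p\<in>A \<times> A. ?B p) = UNIV" by (intro UNIV_eq_I[symmetric])
  with cont show ?thesis by (simp only:)
qed

theorem heat_kernel_isometry:
  fixes A :: "('a::{second_countable_topology, t2_space}, 'd::finite) chart set"
  assumes M: "riemannian_manifold A g" and V: "riemannian_measure A g V"
    and H: "is_heat_kernel A g V H" and i: "i \<in> isometries A g" and t: "0 < t"
  shows "H t (i x) (i y) = H t x y"
proof -
  have A: "smooth_structure A" and g: "riemannian_metric A g"
    using M by (auto simp: riemannian_manifold_def)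
  note aut = measure_automorphism_isometry[OF A i V]
  obtain T where T: "is_heat_semigroup A g V T"
    and TH: "\<And>t f. 0 < t \<Longrightarrow> f \<in> L2 V \<Longrightarrow> AE x in V.
       integrable V (\<lambda>y. H t x y * f y) \<and> T t f x = (\<integral>y. H t x y * f y \<partial>V)"
    using H unfolding is_heat_kernel_def by blast
  note cont = continuous_on_heat_kernel[OF A H t]
  \<comment> \<open>A change of variables turns the conjugated semigroup into integration against
    \<open>H t (inv i x) (inv i y)\<close>. The kernel identity thus arises for
    \<open>inv i\<close>, and evaluating it at \<open>i x\<close> and \<open>i y\<close> gives the
    claim.\<close>
  have "H t (inv i (i x)) (inv i (i y)) = H t (i x) (i y)"
  proof (rule continuous_kernel_eq[OF A g V _ cont])
    note inv_comp = continuous_on_compose2[OF isometry_continuous(2)[OF A i] _ subset_UNIV]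
    have "continuous_on UNIV (\<lambda>z. (inv i (fst z), inv i (snd z)))"
      by (intro continuous_on_Pair inv_comp continuous_on_fst continuous_on_snd continuous_on_id)
    from continuous_on_compose2[OF cont this]
    show "continuous_on UNIV (\<lambda>(x, y). H t (inv i x) (inv i y))"
      by (simp add: case_prod_unfold)
    fix f assume f: "f \<in> L2 V"
    note f' = L2_automorphism[OF aut f]
    have "AE x in V. integrable V (\<lambda>y. H t (inv i x) y * f (i y)) \<and>
        T t (\<lambda>y. f (i y)) (inv i x) = (\<integral>y. H t (inv i x) y * f (i y) \<partial>V)"
      by (rule AE_automorphism[OF measure_automorphism_inv[OF aut] TH[OF t f']])
    moreover have "AE x in V. integrable V (\<lambda>y. H t x y * f y) \<and> T t f x = (\<integral>y. H t x y * f y \<partial>V)"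
      by (rule TH[OF t f])
    moreover have "AE x in V. conjugate_semigroup i T t f x = T t f x"
      by (rule heat_semigroup_isometry[OF A i V T _ f]) (use t in simp)
    ultimately show "AE x in V. integrable V (\<lambda>y. H t (inv i x) (inv i y) * f y) \<and>
        integrable V (\<lambda>y. H t x y * f y) \<and>
        (\<integral>y. H t (inv i x) (inv i y) * f y \<partial>V) = (\<integral>y. H t x y * f y \<partial>V)"
    proof eventually_elim
      case (elim x)
      have int: "integrable V (\<lambda>y. H t (inv i x) (inv i y) * f y)"
        using integrable_automorphism[OF measure_automorphism_inv[OF aut], of "\<lambda>y. H t (inv i x) y * f (i y)"] elim
        by (simp add: measure_automorphism_inverse[OF aut])
      have "(\<integral>y. H t (inv i x) (inv i y) * f y \<partial>V) = (\<integral>y. H t (inv i x) y * f (i y) \<partial>V)"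
        using integral_automorphism[OF aut, of "\<lambda>y. H t (inv i x) (inv i y) * f y"] int
        by (simp add: measure_automorphism_inverse[OF aut])
      thus ?case using elim int by (simp add: conjugate_semigroup_def)
    qed
  qed
  thus ?thesis by (simp add: measure_automorphism_inverse[OF aut])
qed

section \<open>Riesz fields\<close>

lemma normal_rv_square_integrable:
  assumes P: "prob_space P" and X: "normal_rv P X"
  shows "integrable P (\<lambda>w. (X w)\<^sup>2)"
proof -
  interpret prob_space P by (rule P)
  from X consider \<mu> \<sigma> where "0 < \<sigma>" "distributed P lborel X (\<lambda>x. ennreal (normal_density \<mu> \<sigma> x))"
    | \<mu> where "X \<in> borel_measurable P" "AE w in P. X w = \<mu>"
    unfolding normal_rv_def by blast
  thus ?thesis
  proof cases
    case (1 \<mu> \<sigma>)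
    \<comment> \<open>This is \<open>x^2 = (x - \<mu>)^2 + 2 \<mu> x - \<mu>^2\<close> under the
      density, which reduces the claim to centred and first moments.\<close>
    have "integrable lborel (\<lambda>x. normal_density \<mu> \<sigma> x * (x - \<mu>)^2
        + (2 * \<mu>) * (normal_density \<mu> \<sigma> x * x) - \<mu>\<^sup>2 * normal_density \<mu> \<sigma> x)"
      using 1(1) by (intro Bochner_Integration.integrable_add Bochner_Integration.integrable_diff
          integrable_mult_right integrable_normal_moment integrable_normal_moment_nz_1 integrable_normal_density)
    also have "(\<lambda>x. normal_density \<mu> \<sigma> x * (x - \<mu>)^2
        + (2 * \<mu>) * (normal_density \<mu> \<sigma> x * x) - \<mu>\<^sup>2 * normal_density \<mu> \<sigma> x)
      = (\<lambda>x. normal_density \<mu> \<sigma> x * x\<^sup>2)"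
      by (simp add: fun_eq_iff power2_eq_square algebra_simps)
    finally show ?thesis
      using distributed_integrable[OF 1(2), of "\<lambda>x. x\<^sup>2"] by simp
  next
    case (2 \<mu>)
    have "integrable P (\<lambda>w. (X w)\<^sup>2) \<longleftrightarrow> integrable P (\<lambda>w. \<mu>\<^sup>2)"
      by (rule integrable_cong_AE) (use 2 in auto)
    thus ?thesis by simp
  qed
qed

text \<open>Needed to split the expectation of a squared increment: linearity of the integral asks
  for integrability of each product. A single variable is normal as the combination over a singleton
  with coefficient 1.\<close>

lemma gaussian_random_field_integrable_prod:
  assumes X: "gaussian_random_field P I X" and ij: "i \<in> I" "j \<in> I"
  shows "integrable P (\<lambda>w. X i w * X j w)"
proof -
  have sq: "integrable P (\<lambda>w. (X k w)\<^sup>2)" if "k \<in> I" for k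
  proof -
    have "normal_rv P (\<lambda>w. \<Sum>l\<in>F. a l * X l w)" if "finite F" "F \<subseteq> I" for F a
      using X that by (simp add: gaussian_random_field_def)
    from this[of "{k}" "\<lambda>_. 1"] that have "normal_rv P (X k)" by simp
    thus ?thesis using X by (intro normal_rv_square_integrable) (auto simp: gaussian_random_field_def)
  qed
  have [measurable]: "X i \<in> borel_measurable P" "X j \<in> borel_measurable P"
    using X ij by (auto simp: gaussian_random_field_def)
  show ?thesis
  proof (rule Bochner_Integration.integrable_bound)
    show "integrable P (\<lambda>w. (X i w)\<^sup>2 + (X j w)\<^sup>2)" using sq ij by auto
    have "\<bar>a * b\<bar> \<le> a\<^sup>2 + b\<^sup>2" for a b :: real
      using sum_squares_bound[of "\<bar>a\<bar>" "\<bar>b\<bar>"] mult_nonneg_nonneg[of "\<bar>a\<bar>" "\<bar>b\<bar>"]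
      unfolding abs_mult power2_abs by linarith
    thus "AE w in P. norm (X i w * X j w) \<le> norm ((X i w)\<^sup>2 + (X j w)\<^sup>2)" by simp
  qed simp
qed

lemma centered_grf_increment:
  assumes "centered_grf P UNIV X"
  shows "(\<integral>w. \<bar>X x w - X y w\<bar>\<^sup>2 \<partial>P) =
    (\<integral>w. X x w * X x w \<partial>P) - 2 * (\<integral>w. X x w * X y w \<partial>P) + (\<integral>w. X y w * X y w \<partial>P)"
proof -
  have i: "integrable P (\<lambda>w. X a w * X b w)" for a b
    using assms by (intro gaussian_random_field_integrable_prod) (auto simp: centered_grf_def)
  have "(\<integral>w. \<bar>X x w - X y w\<bar>\<^sup>2 \<partial>P)
      = (\<integral>w. X x w * X x w - 2 * (X x w * X y w) + X y w * X y w \<partial>P)"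
    by (intro Bochner_Integration.integral_cong refl) (simp add: power2_eq_square algebra_simps)
  also have "\<dots> = (\<integral>w. X x w * X x w \<partial>P) - 2 * (\<integral>w. X x w * X y w \<partial>P) + (\<integral>w. X y w * X y w \<partial>P)"
    by (simp add: i)
  finally show ?thesis .
qed

text \<open>The terms in \<open>z\<close> are collected under one integral, since only the combined
  integrands are known to be integrable, not the individual kernels. In the combination,
  \<open>H t x z\<close> and \<open>H t y z\<close> occur with coefficients -2 and +2, and
  \<open>H t z z\<close> with 1 - 2 + 1.\<close>

lemma riesz_cov_increment:
  assumes "riesz_exists d H z \<alpha>"
  shows "riesz_cov d H z \<alpha> x x - 2 * riesz_cov d H z \<alpha> x y + riesz_cov d H z \<alpha> y y =
    1 / Gamma (real d / 2 + \<alpha>) *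
    set_lebesgue_integral lborel {0<..}
      (\<lambda>t. t powr (real d / 2 + \<alpha> - 1) * (H t x x - 2 * H t x y + H t y y))"
proof -
  let ?R = "\<lambda>x y. riesz_integrand d H z \<alpha> x y"
  have i: "set_integrable lborel {0<..} (?R x y)" for x y
    using assms by (simp add: riesz_exists_def)
  have "(\<lambda>t. t powr (real d / 2 + \<alpha> - 1) * (H t x x - 2 * H t x y + H t y y))
      = (\<lambda>t. (?R x x t - 2 * ?R x y t) + ?R y y t)"
    by (simp add: riesz_integrand_def fun_eq_iff algebra_simps)
  hence "set_lebesgue_integral lborel {0<..}
      (\<lambda>t. t powr (real d / 2 + \<alpha> - 1) * (H t x x - 2 * H t x y + H t y y))
    = set_lebesgue_integral lborel {0<..} (\<lambda>t. (?R x x t - 2 * ?R x y t) + ?R y y t)" by simp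
  also have "\<dots> = set_lebesgue_integral lborel {0<..} (?R x x)
      - 2 * set_lebesgue_integral lborel {0<..} (?R x y) + set_lebesgue_integral lborel {0<..} (?R y y)"
    using i by (simp add: set_integral_add set_integral_diff)
  finally show ?thesis by (simp only: riesz_cov_def) (simp add: ring_distribs)
qed

theorem mainTheorem7:
  fixes A :: "('a::{second_countable_topology, t2_space}, 'd::finite) chart set"
    and g :: "('a, 'd) chart \<Rightarrow> 'a \<Rightarrow> real ^ 'd ^ 'd"
    and V :: "'a measure"
    and H :: "real \<Rightarrow> 'a \<Rightarrow> 'a \<Rightarrow> real"
    and orig :: 'a and \<alpha> :: real
  assumes "riemannian_manifold A g" and "riemannian_complete A g" and "2 \<le> CARD('d)"
    and "riemannian_measure A g V" and "is_heat_kernel A g V H"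
    and "0 < \<alpha>" and "\<alpha> < 1"
  shows "(riesz_exists CARD('d) H orig \<alpha> \<longrightarrow>
            (\<forall>(P :: 'w measure) R. riesz_field CARD('d) H orig \<alpha> P R \<longrightarrow>
               stationary_increments A g P R)) \<and>
         (stat_riesz_exists CARD('d) H \<alpha> \<longrightarrow>
            (\<forall>(P :: 'v measure) hR. stat_riesz_field CARD('d) H \<alpha> P hR \<longrightarrow>
               stationary A g P hR))"
proof (intro conjI impI allI)
  \<comment> \<open>Invariance at positive times suffices, as the covariance integrals run over the
    open half-line.\<close>
  have inv: "H t (i x) (i y) = H t x y" if "i \<in> isometries A g" "0 < t" for i t x y
    by (rule heat_kernel_isometry[OF assms(1,4,5) that])
  {
    fix P :: "'w measure" and R
    assume ex: "riesz_exists CARD('d) H orig \<alpha>" and R: "riesz_field CARD('d) H orig \<alpha> P R"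
    have cent: "centered_grf P UNIV R" using R by (simp add: riesz_field_def)
    \<comment> \<open>An isometry may move \<open>orig\<close>, so the covariance of
      \<open>R\<close> itself need not be invariant; this formula for the increments no longer
      mentions \<open>orig\<close>.\<close>
    have incr: "(\<integral>w. \<bar>R x w - R y w\<bar>\<^sup>2 \<partial>P) = 1 / Gamma (real CARD('d) / 2 + \<alpha>) *
        set_lebesgue_integral lborel {0<..}
          (\<lambda>t. t powr (real CARD('d) / 2 + \<alpha> - 1) * (H t x x - 2 * H t x y + H t y y))" for x y
      using R by (simp only: centered_grf_increment[OF cent] riesz_cov_increment[OF ex, symmetric]
          riesz_field_def)
    have "(\<integral>w. \<bar>R (i x) w - R (i y) w\<bar>\<^sup>2 \<partial>P) = (\<integral>w. \<bar>R x w - R y w\<bar>\<^sup>2 \<partial>P)"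
      if i: "i \<in> isometries A g" for i x y
      unfolding incr
      by (intro arg_cong2[where f = "(*)"] refl set_lebesgue_integral_cong) (auto simp: inv[OF i])
    thus "stationary_increments A g P R"
      using cent by (simp add: stationary_increments_def)
  }
  {
    fix P :: "'v measure" and hR
    assume hR: "stat_riesz_field CARD('d) H \<alpha> P hR"
    have "stat_riesz_cov CARD('d) H \<alpha> (i x) (i y) = stat_riesz_cov CARD('d) H \<alpha> x y"
      if i: "i \<in> isometries A g" for i x y
      unfolding stat_riesz_cov_def
      by (intro arg_cong2[where f = "(*)"] refl set_lebesgue_integral_cong)
         (auto simp: stat_riesz_integrand_def inv[OF i])
    thus "stationary A g P hR"
      using hR by (simp add: stationary_def stat_riesz_field_def)
  }
qed

end
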